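(* Let $p\in(1,\infty)$, let $\mathsf G=(\mathsf V,m,b,c)$ be a (possibly infinite) graph with $m(\mathsf V)<\infty$, let $\emptyset\ne\mathsf V_0\subsetneq\mathsf V$, and assume that $\mathrm{Mean}_p(\mathsf G^{-1};\mathsf V_0)<\infty$. Then $$\lambda_{0,p}(\mathsf G;\mathsf V_0)\ \ge\ \frac1{m(\mathsf V\setminus\mathsf V_0)\,\mathrm{Mean}_p(\mathsf G^{-1};\mathsf V_0)}\ \ge\ \frac1{m(\mathsf V\setminus\mathsf V_0)\,\mathrm{Inr}_p(\mathsf G^{-1};\mathsf V_0)}.$$ In particular, an $\ell^p$-$\ell^p$-Poincaré inequality holds (there is $M>0$ with $\|u\|_{\ell^p(\mathsf V\setminus\mathsf V_0,m)}\le M\,Q_p^{\mathsf G}(u)^{1/p}$ for all $u\in\mathring w^{1,p,p}_{b,c;\mathsf V_0}(\mathsf V,m)$), and $$T_p(\mathsf G;\mathsf V_0)\ <\ m(\mathsf V\setminus\mathsf V_0)^p\,\mathrm{Mean}_p(\mathsf G^{-1};\mathsf V_0)\ \le\ m(\mathsf V\setminus\mathsf V_0)^p\,\mathrm{Inr}_p(\mathsf G^{-1};\mathsf V_0),$$ and $\mathsf G$ is uniquely $1$-$p$-torsional-admissible with Dirichlet conditions at $\mathsf V_0$.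
   Context: A graph $\mathsf G=(\mathsf V,m,b,c)$ consists of a finite or countably infinite set $\mathsf V$, $m:\mathsf V\to(0,\infty)$, a symmetric $b:\mathsf V\times\mathsf V\to[0,\infty)$ with $b(\mathsf v,\mathsf v)=0$ and $\sum_{\mathsf w}b(\mathsf v,\mathsf w)<\infty$ for every $\mathsf v$, and $c:\mathsf V\to[0,\infty)$. $m(A)=\sum_{\mathsf v\in A}m(\mathsf v)$. Energy: $Q_p^{\mathsf G}(u)=\frac1{2p}\sum_{\mathsf v,\mathsf w}b(\mathsf v,\mathsf w)|u(\mathsf v)-u(\mathsf w)|^p+\frac1p\sum_{\mathsf v}c(\mathsf v)|u(\mathsf v)|^p$. For $q\in[1,\infty)$, $\mathring w^{1,p,q}_{b,c;\mathsf V_0}(\mathsf V,m)=\{u\in\ell^q(\mathsf V,m):Q_p^{\mathsf G}(u)<\infty,\ u=0\text{ on }\mathsf V_0\}$. Bottom of the $p$-spectrum and $p$-torsional rigidity: $$\lambda_{0,p}(\mathsf G;\mathsf V_0)=\inf_{0\ne f\in\mathring w^{1,p,p}_{b,c;\mathsf V_0}}\frac{p\,Q_p^{\mathsf G}(f)}{\|f\|^p_{\ell^p(\mathsf V\setminus\mathsf V_0,m)}},\qquad T_p(\mathsf G;\mathsf V_0)=\sup_{0\ne u\in\mathring w^{1,p,1}_{b,c;\mathsf V_0}}\frac{\|u\|^p_{\ell^1(\mathsf V\setminus\mathsf V_0,m)}}{p\,Q_p^{\mathsf G}(u)}.$$ Distances in the edge-weight-inverted graph $\mathsf G^{-1}=(\mathsf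 V,m,b^{-1},c)$, where $b^{-1}(\mathsf v,\mathsf w)=b(\mathsf v,\mathsf w)^{-1}$ if $b(\mathsf v,\mathsf w)>0$ and $0$ otherwise: $\mathrm{dist}_{p,b^{-1}}(\mathsf v,\mathsf w)=\inf\sum_{j=0}^{n-1}b(\mathsf v_j,\mathsf v_{j+1})^{-\frac1{p-1}}$ over all finite paths $(\mathsf v=\mathsf v_0,\dots,\mathsf v_n=\mathsf w)$ with $b(\mathsf v_j,\mathsf v_{j+1})>0$ ($=+\infty$ if there is no path), and $\mathrm{dist}_{p,b^{-1}}(\mathsf v;\mathsf V_0)=\inf_{\mathsf w\in\mathsf V_0}\mathrm{dist}_{p,b^{-1}}(\mathsf v,\mathsf w)$. Then $$\mathrm{Mean}_p(\mathsf G^{-1};\mathsf V_0)=\frac1{m(\mathsf V\setminus\mathsf V_0)}\sum_{\mathsf v\in\mathsf V\setminus\mathsf V_0}\mathrm{dist}_{p,b^{-1}}(\mathsf v;\mathsf V_0)^{p-1}m(\mathsf v),\qquad \mathrm{Inr}_p(\mathsf G^{-1};\mathsf V_0)=\sup_{\mathsf v\in\mathsf V}\mathrm{dist}_{p,b^{-1}}(\mathsf v;\mathsf V_0)^{p-1}\in(0,\infty],$$ with $1/\infty=0$. Uniquely $1$-$p$-torsional-admissible with Dirichlet conditions at $\mathsf V_0$: there is exactly one $u\in\mathring w^{1,p,1}_{b,c;\mathsf V_0}(\mathsf V,m)$ with $$\tfrac12\sum_{\mathsf v,\mathsf w}b(\mathsf v,\mathsf w)|u(\mathsf v)-u(\mathsf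 w)|^{p-2}(u(\mathsf v)-u(\mathsf w))(h(\mathsf v)-h(\mathsf w))+\sum_{\mathsf v}c(\mathsf v)|u(\mathsf v)|^{p-2}u(\mathsf v)h(\mathsf v)=\sum_{\mathsf v}h(\mathsf v)m(\mathsf v)$$ for all $h\in\mathring w^{1,p,1}_{b,c;\mathsf V_0}(\mathsf V,m)$, where $|x|^{p-2}x:=0$ for $x=0$.
   Formalization: The strict bound T_p < m(V∖V_0)^p Mean_p is proved except when V∖V_0 is a single vertex v with exactly one neighbour and c(v)=0, where equality holds and the printed "<" is false; T_p ≤ m(V∖V_0)^p Mean_p is proved in all cases. *)

theory Defs
  imports "HOL-Analysis.Analysis"
begin

text \<open>
  The vertex set is the universe of a countable type. All quantities that may be infinite
  (sums of nonnegative terms, energies, distances, suprema) live in \<^typ>\<open>ennreal\<close>,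
  where \<open>1 / \<infinity> = 0\<close>.
\<close>

locale weighted_graph =
  fixes m :: "'v::countable \<Rightarrow> real"
    and b :: "'v \<Rightarrow> 'v \<Rightarrow> real"
    and c :: "'v \<Rightarrow> real"
  assumes m_pos: "m v > 0"
    and b_nonneg: "b v w \<ge> 0"
    and b_sym: "b v w = b w v"
    and b_diag: "b v v = 0"
    and b_summable: "(\<lambda>w. b v w) summable_on UNIV"
    and c_nonneg: "c v \<ge> 0"

text \<open>Only used with exponents \<open>a > 0\<close>, hence \<open>\<infinity>\<close> to the power \<open>a\<close> is \<open>\<infinity>\<close>.\<close>

definition ennpowr :: "ennreal \<Rightarrow> real \<Rightarrow> ennreal" where
  "ennpowr x a = (if x = \<infinity> then \<infinity> else ennreal (enn2real x powr a))"

definition vol :: "('v \<Rightarrow> real) \<Rightarrow> 'v set \<Rightarrow> ennreal" where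
  "vol m A = (\<Sum>\<^sub>\<infinity>v\<in>A. ennreal (m v))"

definition lnorm :: "real \<Rightarrow> ('v \<Rightarrow> real) \<Rightarrow> 'v set \<Rightarrow> ('v \<Rightarrow> real) \<Rightarrow> ennreal" where
  "lnorm q m A u = ennpowr (\<Sum>\<^sub>\<infinity>v\<in>A. ennreal (\<bar>u v\<bar> powr q * m v)) (1 / q)"

definition energy ::
  "real \<Rightarrow> ('v \<Rightarrow> 'v \<Rightarrow> real) \<Rightarrow> ('v \<Rightarrow> real) \<Rightarrow> ('v \<Rightarrow> real) \<Rightarrow> ennreal" where
  "energy p b c u =
     ennreal (1 / (2 * p)) * (\<Sum>\<^sub>\<infinity>(v, w)\<in>UNIV. ennreal (b v w * \<bar>u v - u w\<bar> powr p))
     + ennreal (1 / p) * (\<Sum>\<^sub>\<infinity>v\<in>UNIV. ennreal (c v * \<bar>u v\<bar> powr p))"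

definition sobolev0 ::
  "real \<Rightarrow> real \<Rightarrow> ('v \<Rightarrow> real) \<Rightarrow> ('v \<Rightarrow> 'v \<Rightarrow> real) \<Rightarrow> ('v \<Rightarrow> real) \<Rightarrow> 'v set \<Rightarrow> ('v \<Rightarrow> real) set"
  where
  "sobolev0 p q m b c V0 =
     {u. lnorm q m UNIV u < \<infinity> \<and> energy p b c u < \<infinity> \<and> (\<forall>v\<in>V0. u v = 0)}"

definition bottom_spectrum ::
  "real \<Rightarrow> ('v \<Rightarrow> real) \<Rightarrow> ('v \<Rightarrow> 'v \<Rightarrow> real) \<Rightarrow> ('v \<Rightarrow> real) \<Rightarrow> 'v set \<Rightarrow> ennreal" where
  "bottom_spectrum p m b c V0 =
     (INF f \<in> sobolev0 p p m b c V0 - {\<lambda>_. 0}.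
        ennreal p * energy p b c f / ennpowr (lnorm p m (- V0) f) p)"

definition torsional_rigidity ::
  "real \<Rightarrow> ('v \<Rightarrow> real) \<Rightarrow> ('v \<Rightarrow> 'v \<Rightarrow> real) \<Rightarrow> ('v \<Rightarrow> real) \<Rightarrow> 'v set \<Rightarrow> ennreal" where
  "torsional_rigidity p m b c V0 =
     (SUP u \<in> sobolev0 p 1 m b c V0 - {\<lambda>_. 0}.
        ennpowr (lnorm 1 m (- V0) u) p / (ennreal p * energy p b c u))"

text \<open>
  A path is the nonempty list of its vertices; the one-vertex list gives distance
  \<open>0\<close> from a vertex to itself.
\<close>

definition paths :: "('v \<Rightarrow> 'v \<Rightarrow> real) \<Rightarrow> 'v \<Rightarrow> 'v \<Rightarrow> 'v list set" where
  "paths b v w =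
     {xs. xs \<noteq> [] \<and> hd xs = v \<and> last xs = w \<and> successively (\<lambda>x y. b x y > 0) xs}"

definition dist_inv :: "real \<Rightarrow> ('v \<Rightarrow> 'v \<Rightarrow> real) \<Rightarrow> 'v \<Rightarrow> 'v \<Rightarrow> ennreal" where
  "dist_inv p b v w =
     (INF xs \<in> paths b v w.
        \<Sum>j<length xs - 1. ennreal (b (xs ! j) (xs ! Suc j) powr (- (1 / (p - 1)))))"

definition dist_inv_set :: "real \<Rightarrow> ('v \<Rightarrow> 'v \<Rightarrow> real) \<Rightarrow> 'v \<Rightarrow> 'v set \<Rightarrow> ennreal" where
  "dist_inv_set p b v V0 = (INF w \<in> V0. dist_inv p b v w)"

definition Mean_inv :: "real \<Rightarrow> ('v \<Rightarrow> real) \<Rightarrow> ('v \<Rightarrow> 'v \<Rightarrow> real) \<Rightarrow> 'v set \<Rightarrow> ennreal" where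
  "Mean_inv p m b V0 =
     1 / vol m (- V0) *
     (\<Sum>\<^sub>\<infinity>v\<in>- V0. ennpowr (dist_inv_set p b v V0) (p - 1) * ennreal (m v))"

definition Inr_inv :: "real \<Rightarrow> ('v \<Rightarrow> 'v \<Rightarrow> real) \<Rightarrow> 'v set \<Rightarrow> ennreal" where
  "Inr_inv p b V0 = (SUP v. ennpowr (dist_inv_set p b v V0) (p - 1))"

text \<open>
  The sums in the weak equation converge absolutely for \<open>u\<close>, \<open>h\<close> in the space (Hoelder's
  inequality and finiteness of the energies). Since \<open>0 powr a = 0\<close>, the expression
  \<open>\<bar>x\<bar> powr (p - 2) * x\<close> vanishes at \<open>x = 0\<close> for every \<open>p\<close>.
\<close>

definition torsion_function ::
  "real \<Rightarrow> ('v \<Rightarrow> real) \<Rightarrow> ('v \<Rightarrow> 'v \<Rightarrow> real) \<Rightarrow> ('v \<Rightarrow> real) \<Rightarrow> 'v set \<Rightarrow> ('v \<Rightarrow> real) \<Rightarrow> bool"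
  where
  "torsion_function p m b c V0 u \<longleftrightarrow>
     u \<in> sobolev0 p 1 m b c V0 \<and>
     (\<forall>h \<in> sobolev0 p 1 m b c V0.
        1 / 2 * (\<Sum>\<^sub>\<infinity>(v, w)\<in>UNIV.
                   b v w * (\<bar>u v - u w\<bar> powr (p - 2) * (u v - u w)) * (h v - h w))
        + (\<Sum>\<^sub>\<infinity>v\<in>UNIV. c v * (\<bar>u v\<bar> powr (p - 2) * u v) * h v)
        = (\<Sum>\<^sub>\<infinity>v\<in>UNIV. h v * m v))"

definition uniquely_torsional_admissible ::
  "real \<Rightarrow> ('v \<Rightarrow> real) \<Rightarrow> ('v \<Rightarrow> 'v \<Rightarrow> real) \<Rightarrow> ('v \<Rightarrow> real) \<Rightarrow> 'v set \<Rightarrow> bool" where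
  "uniquely_torsional_admissible p m b c V0 \<longleftrightarrow> (\<exists>!u. torsion_function p m b c V0 u)"

text \<open>
  There is a single vertex off \<open>V0\<close>, with exactly one incident edge and no potential.
  Writing \<open>v\<close> for this vertex and \<open>w\<close> for its neighbour, the torsional rigidity and
  \<open>m(V - V0)\<^sup>p\<close> times the mean distance both equal \<open>m(v)\<^sup>p / b(v, w)\<close>, so the bound
  of the former by the latter cannot be strict for such graphs.
\<close>

definition single_edge_graph :: "('v \<Rightarrow> 'v \<Rightarrow> real) \<Rightarrow> ('v \<Rightarrow> real) \<Rightarrow> 'v set \<Rightarrow> bool" where
  "single_edge_graph b c V0 \<longleftrightarrow>
     (\<exists>v w. - V0 = {v} \<and> {x. b v x > 0} = {w} \<and> c v = 0)"

end

theory Submission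
  imports Defs
begin

text \<open>
  Write \<open>E u = p * Q u\<close> and \<open>D v = dist (v; V0) powr (p - 1)\<close>. Telescoping \<open>u\<close> along a simple path
  from \<open>v\<close> to \<open>V0\<close> and applying Hoelder's inequality gives \<open>|u v| powr p \<le> D v * E u\<close>; summing this
  bound against \<open>m\<close> yields the estimates of the spectral bottom and of the torsional rigidity.

  The latter is strict if \<open>D\<close> is not constant off \<open>V0\<close>, by strict concavity of the \<open>p\<close>-th root. If
  \<open>D\<close> is constant, every vertex off \<open>V0\<close> is joined to \<open>V0\<close> by edges of weight arbitrarily close to
  \<open>1 / D\<close>. Two such vertices cannot both saturate the pointwise bound, and a single one cannot do so
  if there is a further edge or a potential.

  The functions vanishing on \<open>V0\<close> with \<open>E u \<le> 1\<close> form a compact set for pointwise convergence, on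
  which \<open>u \<mapsto> \<Sum>v. u v * m v\<close> is continuous. A maximiser, suitably rescaled, is the torsion function;
  uniqueness follows from the strict monotonicity of \<open>x \<mapsto> |x| powr (p - 2) * x\<close>.
\<close>

section \<open>Inequalities for real powers\<close>

text \<open>A strictly concave function lies below its tangent, here the one at 1. With
  \<open>s\<close> the value of the tangent, the weights \<open>1 / p\<close> and
  \<open>1 - 1 / p\<close> average \<open>z / s\<close> and \<open>1 / s\<close> to 1; it remains to
  apply \<open>ln t \<le> t - 1\<close> to both, strictly at \<open>1 / s\<close>.\<close>

lemma powr_inverse_less:
  fixes z p :: real
  assumes "1 < p" "0 \<le> z" "z \<noteq> 1"
  shows "z powr (1 / p) < 1 + (z - 1) / p"
proof (cases "z = 0")
  case True
  then show ?thesis using assms by simp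
next
  case False
  define s where "s = 1 + (z - 1) / p"
  have z: "z > 0" using False assms by simp
  have "(p - 1) / p > 0" using assms by simp
  then have s: "s > 0" using z assms unfolding s_def by (simp add: field_simps)
  have "s \<noteq> 1" using assms by (simp add: s_def)
  then have "1 / s \<noteq> 1" by simp
  then have "ln (1 / s) < 1 / s - 1"
    using ln_le_minus_one[of "1 / s"] ln_eq_minus_one[of "1 / s"] s
    by (metis divide_pos_pos order_le_less zero_less_one)
  then have 1: "(1 - 1 / p) * ln (1 / s) < (1 - 1 / p) * (1 / s - 1)"
    using assms by simp
  have "ln (z / s) \<le> z / s - 1" using ln_le_minus_one z s by simp
  then have 2: "(1 / p) * ln (z / s) \<le> (1 / p) * (z / s - 1)"
    using assms by (simp add: divide_right_mono)
  have "(1 / p) * (z / s - 1) + (1 - 1 / p) * (1 / s - 1) = (1 + (z - 1) / p) / s - 1"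
    using s assms by (simp add: field_simps)
  also have "\<dots> = 0" using s by (simp add: s_def)
  finally have "(1 / p) * ln (z / s) + (1 - 1 / p) * ln (1 / s) < 0" using 1 2 by linarith
  then have "(1 / p) * ln z < ln s"
    using z s by (simp add: ln_div algebra_simps)
  then have "exp ((1 / p) * ln z) < s" using s by (metis exp_less_cancel_iff exp_ln)
  then show ?thesis using z by (simp add: powr_def s_def)
qed

lemma powr_inverse_le:
  fixes z p :: real
  assumes "1 < p" "0 \<le> z"
  shows "z powr (1 / p) \<le> 1 + (z - 1) / p"
  using powr_inverse_less[OF assms] by (cases "z = 1") auto

text \<open>Conjugate exponents \<open>p\<close> and \<open>p / (p - 1)\<close>, applied to
  \<open>x\<close> and \<open>y powr (p - 1)\<close>. This form serves both the convexity of the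
  p-th power and the edgewise estimate along paths.\<close>

lemma Youngs_inequality_powr:
  fixes x y p :: real
  assumes "1 < p" "0 \<le> x" "0 \<le> y"
  shows "y powr (p - 1) * x \<le> x powr p / p + (1 - 1 / p) * y powr p"
proof -
  have "x * y powr (p - 1) \<le> x powr p / p + (y powr (p - 1)) powr (p / (p - 1)) / (p / (p - 1))"
    using assms by (intro Youngs_inequality) (auto simp: field_simps)
  moreover have "(y powr (p - 1)) powr (p / (p - 1)) = y powr p"
    using assms by (simp add: powr_powr)
  moreover have "y powr p / (p / (p - 1)) = (1 - 1 / p) * y powr p"
    using assms by (simp add: field_simps)
  ultimately show ?thesis by (simp add: mult.commute)
qed

lemma powr_add_le:
  fixes x y p :: real
  assumes "0 \<le> p" "0 \<le> x" "0 \<le> y"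
  shows "(x + y) powr p \<le> 2 powr p * (x powr p + y powr p)"
proof -
  have "(x + y) powr p \<le> (2 * max x y) powr p"
    using assms by (intro powr_mono2) auto
  also have "\<dots> = 2 powr p * max x y powr p" using assms by (simp add: powr_mult)
  also have "\<dots> \<le> 2 powr p * (x powr p + y powr p)"
    by (intro mult_left_mono) (auto simp: max_def)
  finally show ?thesis .
qed

text \<open>The derivative of \<open>\<bar>x\<bar> powr p / p\<close>, which is the nonlinearity of
  the p-Laplacian.\<close>

definition signed_powr :: "real \<Rightarrow> real \<Rightarrow> real" where
  "signed_powr p x = \<bar>x\<bar> powr (p - 2) * x"

text \<open>Only the positive exponent \<open>p - 1\<close> occurs on the right, so continuity at 0
  and monotonicity can be read off even when \<open>p < 2\<close>.\<close>

lemma signed_powr_eq_max: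
  assumes "1 < p"
  shows "signed_powr p x = max x 0 powr (p - 1) - max (- x) 0 powr (p - 1)"
proof -
  have *: "y powr (p - 2) * y = y powr (p - 1)" if "y > 0" for y :: real
    using that powr_add[of y "p - 2" 1] by simp
  show ?thesis
    using *[of x] *[of "- x"] assms
    by (cases x "0 :: real" rule: linorder_cases) (auto simp: signed_powr_def max_def)
qed

lemma continuous_on_signed_powr:
  assumes "1 < p"
  shows "continuous_on S (signed_powr p)"
proof -
  have "continuous_on S (\<lambda>x. max x 0 powr (p - 1) - max (- x) 0 powr (p - 1))"
    using assms by (intro continuous_intros continuous_on_powr') auto
  then show ?thesis using signed_powr_eq_max[OF assms] by (simp cong: continuous_on_cong)
qed

lemma abs_signed_powr:
  assumes "1 < p"
  shows "\<bar>signed_powr p x\<bar> = \<bar>x\<bar> powr (p - 1)"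
  using assms by (auto simp: signed_powr_eq_max max_def)

lemma signed_powr_mult_self:
  assumes "1 < p"
  shows "signed_powr p x * x = \<bar>x\<bar> powr p"
proof (cases "x = 0")
  case False
  have "signed_powr p x * x = \<bar>x\<bar> powr (p - 2) * \<bar>x\<bar> powr 2"
    using False by (simp add: signed_powr_def power2_eq_square powr_numeral)
  also have "\<dots> = \<bar>x\<bar> powr (p - 2 + 2)" by (simp only: powr_add)
  finally show ?thesis by simp
qed (simp add: signed_powr_def)

lemma signed_powr_mult:
  assumes "1 < p" "0 \<le> s"
  shows "signed_powr p (s * x) = s powr (p - 1) * signed_powr p x"
proof (cases "s = 0")
  case False
  then have "s powr (p - 2) * s = s powr (p - 1)"
    using assms powr_add[of s "p - 2" 1] by simp
  then have "s powr (p - 2) * (s * y) = s powr (p - 1) * y" for y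
    by (metis mult.assoc)
  then show ?thesis
    using assms by (simp add: signed_powr_def abs_mult powr_mult mult.left_commute)
qed (simp add: signed_powr_def)

lemma signed_powr_strict_mono:
  assumes "1 < p" "x < y"
  shows "signed_powr p x < signed_powr p y"
proof (cases "y > 0")
  case True
  then have "max x 0 powr (p - 1) < max y 0 powr (p - 1)"
    using assms by (intro powr_less_mono2) auto
  moreover have "max (- y) 0 powr (p - 1) \<le> max (- x) 0 powr (p - 1)"
    using assms by (intro powr_mono2) auto
  ultimately show ?thesis unfolding signed_powr_eq_max[OF assms(1)] by linarith
next
  case False
  then have "max (- y) 0 powr (p - 1) < max (- x) 0 powr (p - 1)"
    using assms by (intro powr_less_mono2) auto
  then show ?thesis using assms False by (simp add: signed_powr_eq_max)
qed

lemma signed_powr_monotone: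
  assumes "1 < p"
  shows "(signed_powr p x - signed_powr p y) * (x - y) \<ge> 0"
    and "(signed_powr p x - signed_powr p y) * (x - y) = 0 \<longleftrightarrow> x = y"
  using signed_powr_strict_mono[OF assms, of x y] signed_powr_strict_mono[OF assms, of y x]
  by (cases x y rule: linorder_cases; auto simp: mult_nonneg_nonneg mult_nonpos_nonpos)+

text \<open>Convexity of \<open>\<bar>x\<bar> powr p / p\<close>, with the tangent taken at
  \<open>y\<close>; Young's inequality handles the mixed term.\<close>

lemma signed_powr_tangent:
  assumes "1 < p"
  shows "\<bar>y\<bar> powr p / p - \<bar>x\<bar> powr p / p \<le> signed_powr p y * (y - x)"
proof -
  have "signed_powr p y * x \<le> \<bar>y\<bar> powr (p - 1) * \<bar>x\<bar>"
    by (metis abs_ge_self abs_mult abs_signed_powr assms)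
  also have "\<dots> \<le> \<bar>x\<bar> powr p / p + (1 - 1 / p) * \<bar>y\<bar> powr p"
    using assms by (intro Youngs_inequality_powr) auto
  finally show ?thesis
    using signed_powr_mult_self[OF assms, of y] by (simp add: algebra_simps)
qed

text \<open>Supplies the summable majorant for the weak form, for summability as well as for passing
  to limits.\<close>

lemma signed_powr_mult_le:
  assumes "1 < p"
  shows "\<bar>signed_powr p x * y\<bar> \<le> \<bar>x\<bar> powr p + \<bar>y\<bar> powr p"
proof -
  have "\<bar>signed_powr p x * y\<bar> \<le> \<bar>y\<bar> powr p / p + (1 - 1 / p) * \<bar>x\<bar> powr p"
    using Youngs_inequality_powr[OF assms, of "\<bar>y\<bar>" "\<bar>x\<bar>"] by (simp add: abs_mult abs_signed_powr assms)
  also have "\<dots> \<le> \<bar>y\<bar> powr p + \<bar>x\<bar> powr p"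
    using assms by (intro add_mono mult_left_le_one_le) (simp_all add: divide_le_eq mult_le_cancel_left1)
  finally show ?thesis by simp
qed

section \<open>Infinite sums\<close>

text \<open>The Weierstrass M-test along the filter of finite index sets, followed by continuity of
  uniform limits.\<close>

lemma continuous_on_infsum:
  fixes f :: "'a \<Rightarrow> 'b::topological_space \<Rightarrow> 'c::banach"
  assumes "\<And>x. x \<in> X \<Longrightarrow> continuous_on Y (f x)"
    and "\<And>x y. x \<in> X \<Longrightarrow> y \<in> Y \<Longrightarrow> norm (f x y) \<le> M x"
    and "M summable_on X"
  shows "continuous_on Y (\<lambda>y. \<Sum>\<^sub>\<infinity>x\<in>X. f x y)"
proof (rule uniform_limit_theorem)
  show "uniform_limit Y (\<lambda>F y. \<Sum>x\<in>F. f x y) (\<lambda>y. \<Sum>\<^sub>\<infinity>x\<in>X. f x y) (finite_subsets_at_top X)"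
    using assms by (intro Weierstrass_m_test_general) auto
  show "\<forall>\<^sub>F F in finite_subsets_at_top X. continuous_on Y (\<lambda>y. \<Sum>x\<in>F. f x y)"
    using assms(1)
    by (intro eventually_finite_subsets_at_top_weakI continuous_on_sum) auto
qed simp

lemma
  fixes f g :: "'a \<Rightarrow> real"
  assumes "f summable_on A" "g summable_on A"
  shows summable_on_diff_real: "(\<lambda>x. f x - g x) summable_on A"
    and infsum_diff_real: "(\<Sum>\<^sub>\<infinity>x\<in>A. f x - g x) = infsum f A - infsum g A"
proof -
  have g: "(\<lambda>x. - g x) summable_on A" using assms(2) by (simp add: summable_on_uminus)
  show "(\<lambda>x. f x - g x) summable_on A" using summable_on_add[OF assms(1) g] by simp
  show "(\<Sum>\<^sub>\<infinity>x\<in>A. f x - g x) = infsum f A - infsum g A"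
    using infsum_add[OF assms(1) g] by (simp add: infsum_uminus)
qed

text \<open>Tychonoff's theorem for a product of intervals; the topology on functions is that of
  pointwise convergence.\<close>

lemma compact_box_fun:
  fixes K :: "'v \<Rightarrow> real"
  shows "compact {u. \<forall>v. \<bar>u v\<bar> \<le> K v}"
proof -
  have "compactin (product_topology (\<lambda>_. euclidean) UNIV) (PiE UNIV (\<lambda>v. {- K v..K v}))"
    by (subst compactin_PiE) auto
  moreover have "PiE UNIV (\<lambda>v. {- K v..K v}) = {u. \<forall>v. \<bar>u v\<bar> \<le> K v}"
    by (simp add: PiE_def Pi_def set_eq_iff abs_le_iff minus_le_iff conj_commute)
  ultimately show ?thesis by (metis compactin_euclidean_iff euclidean_product_topology)
qed

lemma infsum_ennreal_eq:
  fixes f :: "'a \<Rightarrow> real"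
  assumes "f summable_on A" "\<And>x. x \<in> A \<Longrightarrow> f x \<ge> 0"
  shows "(\<Sum>\<^sub>\<infinity>x\<in>A. ennreal (f x)) = ennreal (infsum f A)"
proof -
  have "(\<Sum>\<^sub>\<infinity>x\<in>A. ennreal (f x)) = (SUP F\<in>{F. finite F \<and> F \<subseteq> A}. \<Sum>x\<in>F. ennreal (f x))"
    by (intro nonneg_infsum_complete) auto
  also have "\<dots> = (SUP F\<in>{F. finite F \<and> F \<subseteq> A}. ennreal (sum f F))"
    using assms(2) by (intro SUP_cong refl sum_ennreal) auto
  also have "\<dots> = ennreal (infsum f A)"
    using infsum_nonneg_is_SUPREMUM_ennreal[of f A] assms by simp
  finally show ?thesis .
qed

lemma infsum_ennreal_finite_iff:
  fixes f :: "'a \<Rightarrow> real"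
  assumes "\<And>x. x \<in> A \<Longrightarrow> f x \<ge> 0"
  shows "(\<Sum>\<^sub>\<infinity>x\<in>A. ennreal (f x)) < \<infinity> \<longleftrightarrow> f summable_on A"
proof
  assume fin: "(\<Sum>\<^sub>\<infinity>x\<in>A. ennreal (f x)) < \<infinity>"
  then obtain C where C: "C \<ge> 0" "(\<Sum>\<^sub>\<infinity>x\<in>A. ennreal (f x)) = ennreal C"
    by (cases "\<Sum>\<^sub>\<infinity>x\<in>A. ennreal (f x)" rule: ennreal_cases) auto
  have sup: "(\<Sum>\<^sub>\<infinity>x\<in>A. ennreal (f x)) = (SUP F\<in>{F. finite F \<and> F \<subseteq> A}. \<Sum>x\<in>F. ennreal (f x))"
    by (intro nonneg_infsum_complete) auto
  have "sum f F \<le> C" if "finite F" "F \<subseteq> A" for F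
  proof -
    have "ennreal (sum f F) = (\<Sum>x\<in>F. ennreal (f x))"
      using assms that by (intro sum_ennreal[symmetric]) auto
    also have "\<dots> \<le> ennreal C"
      unfolding C(2)[symmetric] sup using that by (intro SUP_upper) auto
    finally show ?thesis using C(1) by simp
  qed
  then show "f summable_on A"
    using assms
    by (intro nonneg_bounded_partial_sums_imp_summable_on[where C = C]
        eventually_finite_subsets_at_top_weakI) auto
qed (simp add: infsum_ennreal_eq assms)

lemma
  fixes f :: "'a + 'b \<Rightarrow> real"
  shows summable_on_sum_type_iff: "f summable_on UNIV \<longleftrightarrow>
      (\<lambda>x. f (Inl x)) summable_on UNIV \<and> (\<lambda>y. f (Inr y)) summable_on UNIV"
    and infsum_sum_type: "(\<lambda>x. f (Inl x)) summable_on UNIV \<Longrightarrow> (\<lambda>y. f (Inr y)) summable_on UNIV \<Longrightarrow>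
      infsum f UNIV = (\<Sum>\<^sub>\<infinity>x. f (Inl x)) + (\<Sum>\<^sub>\<infinity>y. f (Inr y))"
proof -
  have l: "f summable_on range Inl \<longleftrightarrow> (\<lambda>x. f (Inl x)) summable_on UNIV"
    by (simp add: summable_on_reindex o_def)
  have r: "f summable_on range Inr \<longleftrightarrow> (\<lambda>x. f (Inr x)) summable_on UNIV"
    by (simp add: summable_on_reindex o_def)
  have U: "(UNIV :: ('a + 'b) set) = range Inl \<union> range Inr" by (rule UNIV_sum)
  have disj: "range Inl \<inter> range Inr = ({} :: ('a + 'b) set)" by auto
  show "f summable_on UNIV \<longleftrightarrow>
      (\<lambda>x. f (Inl x)) summable_on UNIV \<and> (\<lambda>y. f (Inr y)) summable_on UNIV"
    using summable_on_Un_disjoint[OF _ _ disj, of f] summable_on_subset_banach[of f UNIV]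
    unfolding l r U[symmetric] by (metis l r subset_UNIV)
  assume "(\<lambda>x. f (Inl x)) summable_on UNIV" "(\<lambda>y. f (Inr y)) summable_on UNIV"
  then have "infsum f UNIV = infsum f (range Inl) + infsum f (range Inr)"
    unfolding U by (intro infsum_Un_disjoint disj) (simp_all only: l r)
  then show "infsum f UNIV = (\<Sum>\<^sub>\<infinity>x. f (Inl x)) + (\<Sum>\<^sub>\<infinity>y. f (Inr y))"
    by (simp add: infsum_reindex o_def)
qed

lemma one_divide_antimono_ennreal:
  fixes x y :: ennreal
  assumes "x \<le> y"
  shows "1 / y \<le> 1 / x"
proof (cases "x = 0 \<or> y = \<infinity>")
  case False
  then obtain r s where rs: "x = ennreal r" "y = ennreal s" "r > 0" "s \<ge> 0"
    using assms by (cases x rule: ennreal_cases; cases y rule: ennreal_cases) (auto simp: less_le top_unique)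
  then have "r \<le> s" using assms by simp
  then show ?thesis
    using rs divide_ennreal[of 1 r] divide_ennreal[of 1 s] by (simp add: ennreal_leI divide_left_mono frac_le)
qed auto

lemma ennpowr_ennreal: "x \<ge> 0 \<Longrightarrow> ennpowr (ennreal x) a = ennreal (x powr a)"
  by (simp add: ennpowr_def)

section \<open>Weak solutions for abstract p-energies\<close>

text \<open>
  An abstract \<open>p\<close>-energy \<open>\<Sum>i. k i * |\<delta> i u|\<^sup>p\<close> whose finiteness controls \<open>u\<close> pointwise. The graph
  energy is the case where \<open>i\<close> ranges over the disjoint sum of ordered vertex pairs and vertices.
\<close>

locale p_energy_form =
  fixes p :: real
    and k :: "'i \<Rightarrow> real"
    and \<delta> :: "'i \<Rightarrow> ('v \<Rightarrow> real) \<Rightarrow> real"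
    and m G :: "'v \<Rightarrow> real"
    and V0 :: "'v set"
  assumes p: "1 < p"
    and k_nonneg: "k i \<ge> 0"
    and \<delta>_linear: "\<delta> i (\<lambda>v. s * u v + t * h v) = s * \<delta> i u + t * \<delta> i h"
    and \<delta>_continuous: "continuous_on UNIV (\<delta> i)"
    and m_nonneg: "m v \<ge> 0"
    and G_summable: "(\<lambda>v. G v * m v) summable_on UNIV"
    and bound: "(\<lambda>i. k i * \<bar>\<delta> i u\<bar> powr p) summable_on UNIV \<Longrightarrow> (\<And>v. v \<in> V0 \<Longrightarrow> u v = 0) \<Longrightarrow>
        \<bar>u v\<bar> \<le> G v * (\<Sum>\<^sub>\<infinity>i. k i * \<bar>\<delta> i u\<bar> powr p) powr (1 / p)"
begin

definition E :: "('v \<Rightarrow> real) \<Rightarrow> real" where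
  "E u = (\<Sum>\<^sub>\<infinity>i. k i * \<bar>\<delta> i u\<bar> powr p)"

definition X :: "('v \<Rightarrow> real) set" where
  "X = {u. (\<lambda>i. k i * \<bar>\<delta> i u\<bar> powr p) summable_on UNIV \<and> (\<forall>v\<in>V0. u v = 0)}"

text \<open>The directional derivative of \<open>E / p\<close> at \<open>u\<close> along
  \<open>h\<close>, that is, the weak form of the p-Laplacian.\<close>

definition flux :: "('v \<Rightarrow> real) \<Rightarrow> ('v \<Rightarrow> real) \<Rightarrow> real" where
  "flux u h = (\<Sum>\<^sub>\<infinity>i. k i * signed_powr p (\<delta> i u) * \<delta> i h)"

definition load :: "('v \<Rightarrow> real) \<Rightarrow> real" where
  "load u = (\<Sum>\<^sub>\<infinity>v. u v * m v)"

lemma \<delta>_zero [simp]: "\<delta> i (\<lambda>_. 0) = 0"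
  using \<delta>_linear[of i 0 "\<lambda>_. 0" 0 "\<lambda>_. 0"] by simp

lemma \<delta>_scale: "\<delta> i (\<lambda>v. s * u v) = s * \<delta> i u"
  using \<delta>_linear[of i s u 0 u] by simp

lemma X_summable: "u \<in> X \<Longrightarrow> (\<lambda>i. k i * \<bar>\<delta> i u\<bar> powr p) summable_on UNIV"
  by (simp add: X_def)

lemma X_bound: "u \<in> X \<Longrightarrow> \<bar>u v\<bar> \<le> G v * E u powr (1 / p)"
  unfolding X_def E_def by (blast intro: bound)

lemma E_nonneg: "E u \<ge> 0"
  unfolding E_def by (intro infsum_nonneg) (simp add: k_nonneg)

lemma X_zero: "(\<lambda>_. 0) \<in> X"
  by (simp add: X_def)

lemma X_linear:
  assumes "u \<in> X" "h \<in> X"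
  shows "(\<lambda>v. s * u v + t * h v) \<in> X"
proof -
  have "(\<lambda>i. k i * \<bar>\<delta> i (\<lambda>v. s * u v + t * h v)\<bar> powr p) summable_on UNIV"
  proof (rule summable_on_comparison_test)
    show "(\<lambda>i. 2 powr p * \<bar>s\<bar> powr p * (k i * \<bar>\<delta> i u\<bar> powr p)
        + 2 powr p * \<bar>t\<bar> powr p * (k i * \<bar>\<delta> i h\<bar> powr p)) summable_on UNIV"
      by (intro summable_on_add summable_on_cmult_right X_summable assms)
    fix i
    have "\<bar>s * \<delta> i u + t * \<delta> i h\<bar> powr p \<le> (\<bar>s * \<delta> i u\<bar> + \<bar>t * \<delta> i h\<bar>) powr p"
      using p by (intro powr_mono2) auto
    also have "\<dots> \<le> 2 powr p * (\<bar>s * \<delta> i u\<bar> powr p + \<bar>t * \<delta> i h\<bar> powr p)"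
      using p by (intro powr_add_le) auto
    finally have "k i * \<bar>s * \<delta> i u + t * \<delta> i h\<bar> powr p
        \<le> k i * (2 powr p * (\<bar>s * \<delta> i u\<bar> powr p + \<bar>t * \<delta> i h\<bar> powr p))"
      by (rule mult_left_mono[OF _ k_nonneg])
    then show "k i * \<bar>\<delta> i (\<lambda>v. s * u v + t * h v)\<bar> powr p
       \<le> 2 powr p * \<bar>s\<bar> powr p * (k i * \<bar>\<delta> i u\<bar> powr p)
        + 2 powr p * \<bar>t\<bar> powr p * (k i * \<bar>\<delta> i h\<bar> powr p)"
      by (simp add: \<delta>_linear abs_mult powr_mult algebra_simps)
  qed (simp add: k_nonneg)
  then show ?thesis using assms by (simp add: X_def)
qed

lemma X_scale: "u \<in> X \<Longrightarrow> (\<lambda>v. s * u v) \<in> X"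
  using X_linear[of u u s 0] by simp

lemma E_scale: "E (\<lambda>v. s * u v) = \<bar>s\<bar> powr p * E u"
proof -
  have "E (\<lambda>v. s * u v) = (\<Sum>\<^sub>\<infinity>i. \<bar>s\<bar> powr p * (k i * \<bar>\<delta> i u\<bar> powr p))"
    unfolding E_def by (intro infsum_cong) (simp add: \<delta>_scale abs_mult powr_mult)
  then show ?thesis by (simp add: infsum_cmult_right' E_def)
qed

lemma E_eq_0_imp: "u \<in> X \<Longrightarrow> E u = 0 \<Longrightarrow> u = (\<lambda>_. 0)"
  using X_bound[of u] by auto

lemma flux_summable:
  assumes "u \<in> X" "h \<in> X"
  shows "(\<lambda>i. k i * signed_powr p (\<delta> i u) * \<delta> i h) summable_on UNIV"
proof -
  have "(\<lambda>i. norm (k i * signed_powr p (\<delta> i u) * \<delta> i h)) summable_on UNIV"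
  proof (rule summable_on_comparison_test)
    show "(\<lambda>i. k i * \<bar>\<delta> i u\<bar> powr p + k i * \<bar>\<delta> i h\<bar> powr p) summable_on UNIV"
      by (intro summable_on_add X_summable assms)
    fix i
    show "norm (k i * signed_powr p (\<delta> i u) * \<delta> i h) \<le> k i * \<bar>\<delta> i u\<bar> powr p + k i * \<bar>\<delta> i h\<bar> powr p"
      using mult_left_mono[OF signed_powr_mult_le[OF p, of "\<delta> i u" "\<delta> i h"] k_nonneg[of i]] k_nonneg[of i]
      by (simp add: abs_mult algebra_simps)
  qed simp
  then show ?thesis by (rule abs_summable_summable)
qed

lemma load_summable:
  assumes "u \<in> X"
  shows "(\<lambda>v. \<bar>u v\<bar> * m v) summable_on UNIV" "(\<lambda>v. u v * m v) summable_on UNIV"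
proof -
  show *: "(\<lambda>v. \<bar>u v\<bar> * m v) summable_on UNIV"
  proof (rule summable_on_comparison_test)
    show "(\<lambda>v. E u powr (1 / p) * (G v * m v)) summable_on UNIV"
      by (intro summable_on_cmult_right G_summable)
    show "\<bar>u v\<bar> * m v \<le> E u powr (1 / p) * (G v * m v)" for v
      using mult_right_mono[OF X_bound[OF assms, of v] m_nonneg[of v]] by (simp add: algebra_simps)
  qed (simp add: m_nonneg)
  then have "(\<lambda>v. norm (u v * m v)) summable_on UNIV"
    by (simp add: abs_mult m_nonneg)
  then show "(\<lambda>v. u v * m v) summable_on UNIV" by (rule abs_summable_summable)
qed

lemma load_linear:
  assumes "u \<in> X" "h \<in> X"
  shows "load (\<lambda>v. s * u v + t * h v) = s * load u + t * load h"
proof -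
  have "load (\<lambda>v. s * u v + t * h v) = (\<Sum>\<^sub>\<infinity>v. s * (u v * m v) + t * (h v * m v))"
    unfolding load_def by (intro infsum_cong) (simp add: algebra_simps)
  also have "\<dots> = s * load u + t * load h"
    unfolding load_def
    by (subst infsum_add) (auto intro!: summable_on_cmult_right load_summable assms simp: infsum_cmult_right')
  finally show ?thesis .
qed

lemma load_scale: "u \<in> X \<Longrightarrow> load (\<lambda>v. s * u v) = s * load u"
  using load_linear[of u u s 0] by simp

section \<open>Compactness of the energy ball and a maximiser of the load\<close>

lemma closed_energy_sublevel: "closed {u \<in> X. E u \<le> 1}"
proof -
  \<comment> \<open>Bounding the infinite sum by 1 amounts to bounding every finite partial sum, and
    each of these depends continuously on \<open>u\<close> in the product topology.\<close>
  have "{u \<in> X. E u \<le> 1} =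
      (\<Inter>F\<in>{F. finite F}. {u. (\<Sum>i\<in>F. k i * \<bar>\<delta> i u\<bar> powr p) \<le> 1}) \<inter> (\<Inter>v\<in>V0. {u. u v = 0})"
    (is "?A = ?B")
  proof (intro equalityI subsetI)
    fix u assume u: "u \<in> ?A"
    have "(\<Sum>i\<in>F. k i * \<bar>\<delta> i u\<bar> powr p) \<le> E u" if "finite F" for F
      unfolding E_def using u that
      by (intro finite_sum_le_infsum) (auto simp: k_nonneg X_def)
    then show "u \<in> ?B" using u by (force simp: X_def)
  next
    fix u assume u: "u \<in> ?B"
    have s: "(\<lambda>i. k i * \<bar>\<delta> i u\<bar> powr p) summable_on UNIV"
      using u by (intro nonneg_bounded_partial_sums_imp_summable_on[where C = 1])
        (auto simp: k_nonneg intro!: eventually_finite_subsets_at_top_weakI)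
    moreover have "E u \<le> 1"
      unfolding E_def using u by (intro infsum_le_finite_sums s) auto
    ultimately show "u \<in> ?A" using u by (auto simp: X_def)
  qed
  moreover have "closed ?B"
    using p by (intro closed_Int closed_INT ballI closed_Collect_le closed_Collect_eq
        continuous_intros continuous_on_powr' \<delta>_continuous) auto
  ultimately show ?thesis by simp
qed

lemma load_maximizer:
  obtains u where "u \<in> X" "E u \<le> 1" "\<And>w. w \<in> X \<Longrightarrow> E w \<le> 1 \<Longrightarrow> load w \<le> load u"
proof -
  \<comment> \<open>The locale does not fix the sign of \<open>G\<close>, hence the absolute value
    in the box.\<close>
  let ?S = "{u \<in> X. E u \<le> 1}" and ?B = "{u. \<forall>v. \<bar>u v\<bar> \<le> \<bar>G v\<bar>}"
  have sub: "?S \<subseteq> ?B"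
  proof clarify
    fix u v assume u: "u \<in> X" "E u \<le> 1"
    have "\<bar>u v\<bar> \<le> \<bar>G v\<bar> * E u powr (1 / p)"
      using X_bound[OF u(1), of v] by (metis abs_ge_self mult_right_mono order_trans powr_ge_zero)
    also have "\<dots> \<le> \<bar>G v\<bar> * 1"
      using u p E_nonneg by (intro mult_left_mono powr_le1) auto
    finally show "\<bar>u v\<bar> \<le> \<bar>G v\<bar>" by simp
  qed
  have "compact (?B \<inter> ?S)"
    by (intro compact_Int_closed compact_box_fun closed_energy_sublevel)
  then have "compact ?S" using sub by (simp add: Int_absorb1)
  moreover have "(\<lambda>_. 0) \<in> ?S" using X_zero by (simp add: E_def)
  then have "?S \<noteq> {}" by blast
  \<comment> \<open>On the box the terms of the load are dominated by the summable function
    \<open>\<bar>G v\<bar> * m v\<close>.\<close>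
  moreover have "continuous_on ?B load"
    unfolding load_def
  proof (rule continuous_on_infsum)
    have "(\<lambda>v. norm (G v * m v)) summable_on UNIV"
      using G_summable by (rule summable_on_iff_abs_summable_on_real[THEN iffD1])
    then show "(\<lambda>v. \<bar>G v\<bar> * m v) summable_on UNIV"
      by (simp add: abs_mult m_nonneg)
    show "continuous_on ?B (\<lambda>u. u v * m v)" for v
      by (intro continuous_intros continuous_on_subset[OF continuous_on_product_coordinates]) auto
  qed (auto simp: abs_mult m_nonneg mult_right_mono)
  then have "continuous_on ?S load" using sub continuous_on_subset by blast
  ultimately obtain u where "u \<in> ?S" "\<forall>w\<in>?S. load w \<le> load u"
    using continuous_attains_sup by blast
  then show thesis using that by blast
qed

section \<open>First variation of the energy and the weak equation\<close>

lemma flux_scale: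
  assumes "0 \<le> s"
  shows "flux (\<lambda>v. s * u v) h = s powr (p - 1) * flux u h"
proof -
  have "flux (\<lambda>v. s * u v) h = (\<Sum>\<^sub>\<infinity>i. s powr (p - 1) * (k i * signed_powr p (\<delta> i u) * \<delta> i h))"
    unfolding flux_def by (intro infsum_cong) (simp add: \<delta>_scale signed_powr_mult p assms)
  then show ?thesis by (simp add: infsum_cmult_right' flux_def)
qed

lemma flux_right_neg: "flux u (\<lambda>v. - h v) = - flux u h"
proof -
  have "\<delta> i (\<lambda>v. - h v) = - \<delta> i h" for i using \<delta>_scale[of i "-1" h] by simp
  then show ?thesis by (simp add: flux_def infsum_uminus)
qed

text \<open>Convexity with the tangent taken at the perturbed point \<open>w\<close>. The energy
  increment is thus bounded by a flux, and continuity of that flux in \<open>t\<close> replaces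
  differentiation under the sum.\<close>

lemma energy_tangent:
  fixes t :: real
  assumes "u \<in> X" "h \<in> X"
  defines "w \<equiv> \<lambda>v. u v + t * h v"
  shows "(E w - E u) / p \<le> t * flux w h"
proof -
  have w: "w \<in> X" using X_linear[OF assms(1,2), of 1 t] by (simp add: w_def)
  have \<delta>w: "\<delta> i w = \<delta> i u + t * \<delta> i h" for i using \<delta>_linear[of i 1 u t h] by (simp add: w_def)
  have "(E w - E u) / p = (\<Sum>\<^sub>\<infinity>i. (1 / p) * (k i * \<bar>\<delta> i w\<bar> powr p - k i * \<bar>\<delta> i u\<bar> powr p))"
    unfolding E_def infsum_cmult_right'
    by (subst infsum_diff_real) (auto intro!: X_summable w assms)
  also have "\<dots> \<le> (\<Sum>\<^sub>\<infinity>i. t * (k i * signed_powr p (\<delta> i w) * \<delta> i h))"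
  proof (rule infsum_mono)
    show "(\<lambda>i. (1 / p) * (k i * \<bar>\<delta> i w\<bar> powr p - k i * \<bar>\<delta> i u\<bar> powr p)) summable_on UNIV"
      by (intro summable_on_cmult_right summable_on_diff_real X_summable w assms)
    show "(\<lambda>i. t * (k i * signed_powr p (\<delta> i w) * \<delta> i h)) summable_on UNIV"
      by (intro summable_on_cmult_right flux_summable w assms)
    fix i
    have "k i * (\<bar>\<delta> i w\<bar> powr p / p - \<bar>\<delta> i u\<bar> powr p / p) \<le> k i * (signed_powr p (\<delta> i w) * (\<delta> i w - \<delta> i u))"
      by (intro mult_left_mono signed_powr_tangent p k_nonneg)
    then show "(1 / p) * (k i * \<bar>\<delta> i w\<bar> powr p - k i * \<bar>\<delta> i u\<bar> powr p) \<le> t * (k i * signed_powr p (\<delta> i w) * \<delta> i h)"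
      by (simp add: \<delta>w algebra_simps diff_divide_distrib)
  qed
  also have "\<dots> = t * flux w h" by (simp add: infsum_cmult_right' flux_def)
  finally show ?thesis .
qed

text \<open>For \<open>t\<close> in \<open>{0..1}\<close> the terms have a common majorant built
  from the energy terms of \<open>u\<close> and \<open>h\<close>.\<close>

lemma flux_tendsto:
  assumes "u \<in> X" "h \<in> X"
  shows "((\<lambda>t. flux (\<lambda>v. u v + t * h v) h) \<longlongrightarrow> flux u h) (at_right 0)"
proof -
  have \<delta>w: "\<delta> i (\<lambda>v. u v + t * h v) = \<delta> i u + t * \<delta> i h" for i t
    using \<delta>_linear[of i 1 u t h] by simp
  have "continuous_on {0..1} (\<lambda>t. \<Sum>\<^sub>\<infinity>i. k i * signed_powr p (\<delta> i u + t * \<delta> i h) * \<delta> i h)"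
  proof (rule continuous_on_infsum)
    show "continuous_on {0..1} (\<lambda>t. k i * signed_powr p (\<delta> i u + t * \<delta> i h) * \<delta> i h)" for i
      by (intro continuous_intros continuous_on_compose2[OF continuous_on_signed_powr[OF p, of UNIV]]) auto
    show "(\<lambda>i. 2 powr p * (k i * \<bar>\<delta> i u\<bar> powr p) + (2 powr p + 1) * (k i * \<bar>\<delta> i h\<bar> powr p)) summable_on UNIV"
      by (intro summable_on_add summable_on_cmult_right X_summable assms)
    fix i and t :: real assume t: "t \<in> {0..1}"
    have "\<bar>t * \<delta> i h\<bar> \<le> \<bar>\<delta> i h\<bar>" using t by (simp add: abs_mult mult_left_le_one_le)
    then have "\<bar>\<delta> i u + t * \<delta> i h\<bar> powr p \<le> (\<bar>\<delta> i u\<bar> + \<bar>\<delta> i h\<bar>) powr p"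
      using p by (intro powr_mono2) auto
    also have "\<dots> \<le> 2 powr p * (\<bar>\<delta> i u\<bar> powr p + \<bar>\<delta> i h\<bar> powr p)"
      using p by (intro powr_add_le) auto
    finally have "\<bar>signed_powr p (\<delta> i u + t * \<delta> i h) * \<delta> i h\<bar>
        \<le> 2 powr p * (\<bar>\<delta> i u\<bar> powr p + \<bar>\<delta> i h\<bar> powr p) + \<bar>\<delta> i h\<bar> powr p"
      using signed_powr_mult_le[OF p, of "\<delta> i u + t * \<delta> i h" "\<delta> i h"] by linarith
    from mult_left_mono[OF this k_nonneg[of i]]
    show "norm (k i * signed_powr p (\<delta> i u + t * \<delta> i h) * \<delta> i h)
       \<le> 2 powr p * (k i * \<bar>\<delta> i u\<bar> powr p) + (2 powr p + 1) * (k i * \<bar>\<delta> i h\<bar> powr p)"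
      using k_nonneg[of i] by (simp add: abs_mult algebra_simps)
  qed
  then have "continuous_on {0..1} (\<lambda>t. flux (\<lambda>v. u v + t * h v) h)"
    by (simp add: flux_def \<delta>w)
  then have "((\<lambda>t. flux (\<lambda>v. u v + t * h v) h) \<longlongrightarrow> flux u h) (at 0 within {0..1})"
    unfolding continuous_on_def by (auto dest: bspec[where x = 0])
  then show ?thesis by (simp add: at_within_Icc_at_right)
qed

text \<open>A maximiser \<open>u\<close> of the load on the energy ball satisfies the equation up to
  a Lagrange multiplier \<open>\<Lambda>\<close>, the maximal load, which rescaling then
  removes.\<close>

theorem weak_solution_exists:
  "\<exists>u\<in>X. \<forall>h\<in>X. flux u h = load h"
proof -
  obtain u where u: "u \<in> X" "E u \<le> 1" and max: "\<And>w. w \<in> X \<Longrightarrow> E w \<le> 1 \<Longrightarrow> load w \<le> load u"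
    using load_maximizer by blast
  define \<Lambda> where "\<Lambda> = load u"
  have "load (\<lambda>_. 0) \<le> \<Lambda>" unfolding \<Lambda>_def using X_zero by (intro max) (simp_all add: E_def)
  then have \<Lambda>: "\<Lambda> \<ge> 0" by (simp add: load_def)
  \<comment> \<open>Rescaling \<open>w\<close> to energy 1 carries the bound from the energy ball to
    all of \<open>X\<close>.\<close>
  have homog: "load w \<le> \<Lambda> * E w powr (1 / p)" if w: "w \<in> X" for w
  proof (cases "E w = 0")
    case True
    then show ?thesis using E_eq_0_imp[OF w] by (simp add: load_def)
  next
    case False
    then have Ew: "E w > 0" using E_nonneg[of w] by simp
    define s where "s = 1 / E w powr (1 / p)"
    have s: "s > 0" using Ew by (simp add: s_def)
    have "s powr p * E w = 1"
      using Ew p by (simp add: s_def powr_divide powr_powr)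
    then have "load (\<lambda>v. s * w v) \<le> \<Lambda>"
      unfolding \<Lambda>_def using s by (intro max X_scale w) (simp add: E_scale)
    then have "s * load w \<le> \<Lambda>" using load_scale[OF w] by simp
    then show ?thesis using Ew by (simp add: s_def divide_le_eq)
  qed
  \<comment> \<open>Hence \<open>\<Lambda> * E / p - load\<close> attains its minimum at \<open>u\<close>.\<close>
  have minimal: "\<Lambda> * E u / p - load u \<le> \<Lambda> * E w / p - load w" if w: "w \<in> X" for w
  proof -
    \<comment> \<open>The tangent of the p-th root at 1 makes the bound affine in
      \<open>E w\<close>.\<close>
    have "load w \<le> \<Lambda> * (1 + (E w - 1) / p)"
      using homog[OF w] mult_left_mono[OF powr_inverse_le[OF p E_nonneg[of w]] \<Lambda>] by linarith
    moreover have "\<Lambda> * E u / p \<le> \<Lambda> / p"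
      using u(2) \<Lambda> p by (intro divide_right_mono mult_left_le) auto
    moreover have "\<Lambda> * (1 + (E w - 1) / p) = \<Lambda> + \<Lambda> * E w / p - \<Lambda> / p"
      by (simp add: algebra_simps diff_divide_distrib)
    ultimately show ?thesis unfolding \<Lambda>_def by linarith
  qed
  have ineq: "load h \<le> \<Lambda> * flux u h" if h: "h \<in> X" for h
  proof -
    \<comment> \<open>Minimality along \<open>u + t * h\<close>, combined with convexity and divided
      by \<open>t\<close>, leaves an inequality that survives the limit of \<open>t\<close> to 0
      from the right.\<close>
    have "load h \<le> \<Lambda> * flux (\<lambda>v. u v + t * h v) h" if t: "t > 0" for t
    proof -
      let ?w = "\<lambda>v. u v + t * h v"
      have w: "?w \<in> X" "load ?w = load u + t * load h"
        using X_linear[OF u(1) h, of 1 t] load_linear[OF u(1) h, of 1 t] by simp_all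
      have "t * load h \<le> \<Lambda> * ((E ?w - E u) / p)"
        using minimal[OF w(1)] w(2) by (simp add: right_diff_distrib diff_divide_distrib)
      also have "\<dots> \<le> \<Lambda> * (t * flux ?w h)"
        by (intro mult_left_mono energy_tangent u h \<Lambda>)
      finally show ?thesis using t by simp
    qed
    then have "\<forall>\<^sub>F t in at_right 0. load h \<le> \<Lambda> * flux (\<lambda>v. u v + t * h v) h"
      by (simp add: eventually_at_filter)
    then show ?thesis
      by (intro tendsto_lowerbound[OF tendsto_mult_left[OF flux_tendsto[OF u(1) h]]]) auto
  qed
  have eq: "\<Lambda> * flux u h = load h" if h: "h \<in> X" for h
  proof -
    have "(\<lambda>v. - h v) \<in> X" "load (\<lambda>v. - h v) = - load h"
      using X_scale[OF h, of "-1"] load_scale[OF h, of "-1"] by simp_all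
    then show ?thesis using ineq[OF h] ineq[of "\<lambda>v. - h v"] by (simp add: flux_right_neg)
  qed
  \<comment> \<open>The flux is homogeneous of degree \<open>p - 1\<close> in \<open>u\<close>, so
    scaling \<open>u\<close> by this \<open>s\<close> absorbs the factor \<open>\<Lambda>\<close>.
    The case \<open>\<Lambda> = 0\<close> is covered by \<open>0 powr a = 0\<close>.\<close>
  define s where "s = \<Lambda> powr (1 / (p - 1))"
  have "s powr (p - 1) = \<Lambda>" using p \<Lambda> by (simp add: s_def powr_powr)
  moreover have "s \<ge> 0" by (simp add: s_def)
  ultimately have "\<forall>h\<in>X. flux (\<lambda>v. s * u v) h = load h" using eq by (simp add: flux_scale)
  then show ?thesis using X_scale[OF u(1)] by blast
qed

text \<open>Testing both equations with the difference makes a sum of nonnegative monotonicity terms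
  vanish, so every increment of \<open>u - w\<close> with positive weight is 0. A function of zero
  energy vanishes by the pointwise bound.\<close>

theorem weak_solution_unique:
  assumes "u \<in> X" "\<And>h. h \<in> X \<Longrightarrow> flux u h = load h"
    and "w \<in> X" "\<And>h. h \<in> X \<Longrightarrow> flux w h = load h"
  shows "u = w"
proof -
  let ?h = "\<lambda>v. u v - w v"
  let ?f = "\<lambda>i. k i * ((signed_powr p (\<delta> i u) - signed_powr p (\<delta> i w)) * (\<delta> i u - \<delta> i w))"
  have h: "?h \<in> X" using X_linear[OF assms(1,3), of 1 "-1"] by simp
  have \<delta>h: "\<delta> i ?h = \<delta> i u - \<delta> i w" for i using \<delta>_linear[of i 1 u "-1" w] by simp
  have eq: "?f i = k i * signed_powr p (\<delta> i u) * \<delta> i ?h - k i * signed_powr p (\<delta> i w) * \<delta> i ?h" for i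
    by (simp add: \<delta>h algebra_simps)
  have "(\<Sum>\<^sub>\<infinity>i. ?f i) = flux u ?h - flux w ?h"
    unfolding eq flux_def by (intro infsum_diff_real flux_summable assms h)
  also have "\<dots> = 0" using assms h by simp
  finally have sum: "(\<Sum>\<^sub>\<infinity>i. ?f i) = 0" .
  moreover have "?f summable_on UNIV"
    unfolding eq by (intro summable_on_diff_real flux_summable assms h)
  ultimately have "?f i = 0" for i
    by (intro nonneg_infsum_le_0D[where A = UNIV and f = ?f])
      (auto intro!: mult_nonneg_nonneg[OF k_nonneg signed_powr_monotone(1)[OF p]])
  then have "k i = 0 \<or> \<delta> i ?h = 0" for i
    using signed_powr_monotone(2)[OF p] by (simp add: \<delta>h)
  then have "k i * \<bar>\<delta> i ?h\<bar> powr p = 0" for i by (metis abs_0 mult_zero_left mult_zero_right powr_0)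
  then have "E ?h = 0" unfolding E_def by (intro infsum_0)
  then have "?h = (\<lambda>_. 0)" using E_eq_0_imp h by blast
  then show ?thesis by (simp add: fun_eq_iff)
qed

end

section \<open>Paths\<close>

text \<open>A recursive form of the indexed sum in \<open>dist_inv\<close>, suited to list
  induction.\<close>

fun path_sum :: "('v \<Rightarrow> 'v \<Rightarrow> real) \<Rightarrow> 'v list \<Rightarrow> real" where
  "path_sum f (x # y # xs) = f x y + path_sum f (y # xs)"
| "path_sum f xs = 0"

lemma path_sum_append: "path_sum f (xs @ y # ys) = path_sum f (xs @ [y]) + path_sum f (y # ys)"
proof (induction xs)
  case (Cons x xs)
  then show ?case by (cases xs) auto
qed simp

lemma path_sum_nonneg: "(\<And>x y. f x y \<ge> 0) \<Longrightarrow> path_sum f xs \<ge> 0"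
  by (induction f xs rule: path_sum.induct) auto

lemma path_sum_mono:
  "successively P xs \<Longrightarrow> (\<And>x y. P x y \<Longrightarrow> f x y \<le> g x y) \<Longrightarrow> path_sum f xs \<le> path_sum g xs"
  by (induction f xs rule: path_sum.induct) (auto intro: add_mono)

lemma path_sum_linear:
  "path_sum (\<lambda>x y. s * f x y + t * g x y) xs = s * path_sum f xs + t * path_sum g xs"
  by (induction f xs rule: path_sum.induct) (auto simp: algebra_simps)

lemma path_sum_eq_sum: "path_sum f xs = (\<Sum>j<length xs - 1. f (xs ! j) (xs ! Suc j))"
  by (induction f xs rule: path_sum.induct) (simp_all add: sum.lessThan_Suc_shift del: sum.lessThan_Suc)

lemma path_sum_triangle:
  "xs \<noteq> [] \<Longrightarrow> \<bar>u (hd xs) - u (last xs)\<bar> \<le> path_sum (\<lambda>x y. \<bar>u x - u y\<bar>) xs"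
proof (induction xs rule: induct_list012)
  case (3 x y zs)
  then show ?case by fastforce
qed auto

text \<open>On a simple path no edge is repeated, so its two orientations can be charged to separate
  entries of the product. The factor 2 matches the half that ordered pairs carry in the
  energy.\<close>

lemma path_sum_le_sum_Times:
  assumes "distinct xs" "\<And>x y. g x y \<ge> 0" "\<And>x y. g x y = g y x"
  shows "2 * path_sum g xs \<le> (\<Sum>(x, y)\<in>set xs \<times> set xs. g x y)"
  using assms(1)
proof (induction xs rule: induct_list012)
  case (3 x y zs)
  let ?A = "set (y # zs)"
  \<comment> \<open>Since \<open>x\<close> does not occur in \<open>y # zs\<close>, both
    orientations of the first edge are new pairs.\<close>
  have "2 * path_sum g (x # y # zs) \<le> g x y + g y x + (\<Sum>(x, y)\<in>?A \<times> ?A. g x y)"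
    using 3 assms(3)[of x y] by simp
  also have "\<dots> = (\<Sum>(x, y)\<in>insert (x, y) (insert (y, x) (?A \<times> ?A)). g x y)"
    using 3(3) by (subst sum.insert; auto)+
  also have "\<dots> \<le> (\<Sum>(x, y)\<in>set (x # y # zs) \<times> set (x # y # zs). g x y)"
    using assms(2) by (intro sum_mono2) auto
  finally show ?case .
qed (simp_all add: assms(2))

text \<open>Cutting out the loop between two occurrences of a vertex shortens the list and does not
  increase a sum of nonnegative terms. Comparison with the energy requires that no edge is used
  twice.\<close>

lemma simple_path_exists:
  assumes "xs \<in> paths b v w" "\<And>x y. f x y \<ge> 0"
  shows "\<exists>ys\<in>paths b v w. distinct ys \<and> path_sum f ys \<le> path_sum f xs"
  using assms(1)
proof (induction xs rule: length_induct)
  case (1 xs)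
  show ?case
  proof (cases "distinct xs")
    case False
    then obtain as y bs cs where xs: "xs = as @ [y] @ bs @ [y] @ cs"
      using not_distinct_decomp by blast
    let ?ys = "as @ y # cs"
    have "?ys \<in> paths b v w"
      using 1(2) unfolding xs paths_def
      by (cases as; cases cs; auto simp: successively_append_iff successively_Cons hd_append split: if_splits)
    moreover have "path_sum f xs = path_sum f (as @ [y]) + (path_sum f (y # bs @ [y]) + path_sum f (y # cs))"
      using path_sum_append[of f as y "bs @ y # cs"] path_sum_append[of f "y # bs" y cs] by (simp add: xs)
    then have le: "path_sum f ?ys \<le> path_sum f xs"
      using path_sum_nonneg[of f "y # bs @ [y]", OF assms(2)] path_sum_append[of f as y cs] by simp
    moreover have "length ?ys < length xs" by (simp add: xs)
    ultimately obtain zs where "zs \<in> paths b v w" "distinct zs" "path_sum f zs \<le> path_sum f ?ys"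
      using 1(1) by blast
    then show ?thesis using le by force
  qed (use 1(2) in blast)
qed

lemma dist_inv_set_greatest:
  assumes "\<And>w xs. w \<in> V0 \<Longrightarrow> xs \<in> paths b v w \<Longrightarrow> r \<le> path_sum (\<lambda>x y. b x y powr (- (1 / (p - 1)))) xs"
  shows "ennreal r \<le> dist_inv_set p b v V0"
  unfolding dist_inv_set_def dist_inv_def
proof (intro INF_greatest)
  fix w xs assume "w \<in> V0" "xs \<in> paths b v w"
  then have "ennreal r \<le> ennreal (\<Sum>j<length xs - 1. b (xs ! j) (xs ! Suc j) powr (- (1 / (p - 1))))"
    by (intro ennreal_leI assms[unfolded path_sum_eq_sum])
  then show "ennreal r \<le> (\<Sum>j<length xs - 1. ennreal (b (xs ! j) (xs ! Suc j) powr (- (1 / (p - 1)))))"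
    by (subst sum_ennreal) auto
qed

lemma dist_inv_set_le:
  assumes "w \<in> V0" "xs \<in> paths b v w"
  shows "dist_inv_set p b v V0 \<le> ennreal (path_sum (\<lambda>x y. b x y powr (- (1 / (p - 1)))) xs)"
proof -
  have "dist_inv_set p b v V0 \<le> (\<Sum>j<length xs - 1. ennreal (b (xs ! j) (xs ! Suc j) powr (- (1 / (p - 1)))))"
    unfolding dist_inv_set_def dist_inv_def using assms by (meson INF_lower2 order_refl)
  also have "\<dots> = ennreal (path_sum (\<lambda>x y. b x y powr (- (1 / (p - 1)))) xs)"
    by (simp add: path_sum_eq_sum sum_ennreal)
  finally show ?thesis .
qed

lemma paths_Cons:
  assumes "xs \<in> paths b v w" "v \<noteq> w"
  obtains y ys where "xs = v # y # ys" "b v y > 0" "y # ys \<in> paths b y w"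
proof -
  obtain zs where zs: "xs = v # zs" using assms(1) by (cases xs) (auto simp: paths_def)
  with assms obtain y ys where "zs = y # ys" by (cases zs) (auto simp: paths_def)
  then show thesis using assms(1) zs by (intro that) (auto simp: paths_def)
qed

section \<open>Graphs with finite mean distance to the Dirichlet set\<close>

locale torsion_graph = weighted_graph m b c
  for m :: "'v::countable \<Rightarrow> real" and b :: "'v \<Rightarrow> 'v \<Rightarrow> real" and c :: "'v \<Rightarrow> real" +
  fixes p :: real and V0 :: "'v set"
  assumes p: "1 < p"
    and vol_finite: "vol m UNIV < \<infinity>"
    and V0_proper: "V0 \<subset> UNIV"
    and Mean_finite: "Mean_inv p m b V0 < \<infinity>"
begin

section \<open>Distances to the Dirichlet set and their mean\<close>

abbreviation len :: "'v \<Rightarrow> 'v \<Rightarrow> real" where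
  "len x y \<equiv> b x y powr (- (1 / (p - 1)))"

text \<open>Ordered pairs count every edge twice, hence the half. With these weights the sum over
  the index type is \<open>p\<close> times the energy.\<close>

definition coeff_at :: "('v \<times> 'v) + 'v \<Rightarrow> real" where
  "coeff_at i = (case i of Inl (v, w) \<Rightarrow> b v w / 2 | Inr v \<Rightarrow> c v)"

definition increment :: "('v \<times> 'v) + 'v \<Rightarrow> ('v \<Rightarrow> real) \<Rightarrow> real" where
  "increment i u = (case i of Inl (v, w) \<Rightarrow> u v - u w | Inr v \<Rightarrow> u v)"

lemma coeff_at_nonneg: "coeff_at i \<ge> 0"
  using b_nonneg c_nonneg by (auto simp: coeff_at_def split: sum.split prod.split)

definition p_energy :: "('v \<Rightarrow> real) \<Rightarrow> real" where
  "p_energy u = (\<Sum>\<^sub>\<infinity>i. coeff_at i * \<bar>increment i u\<bar> powr p)"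

text \<open>\<open>sobolev0_1_eq\<close> identifies this set with the space for exponent 1, and
  \<open>sobolev0_p_subset\<close> places the one for exponent \<open>p\<close> inside it.\<close>

definition finite_energy :: "('v \<Rightarrow> real) set" where
  "finite_energy = {u. (\<lambda>i. coeff_at i * \<bar>increment i u\<bar> powr p) summable_on UNIV \<and> (\<forall>v\<in>V0. u v = 0)}"

lemma p_energy_nonneg: "p_energy u \<ge> 0"
  unfolding p_energy_def by (intro infsum_nonneg) (simp add: coeff_at_nonneg)

lemma sum_le_p_energy:
  assumes "u \<in> finite_energy" "finite I"
  shows "(\<Sum>i\<in>I. coeff_at i * \<bar>increment i u\<bar> powr p) \<le> p_energy u"
  unfolding p_energy_def using assms
  by (intro finite_sum_le_infsum) (auto simp: coeff_at_nonneg finite_energy_def)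

lemma dist_eq_0:
  assumes "v \<in> V0"
  shows "dist_inv_set p b v V0 = 0"
proof -
  have "[v] \<in> paths b v v" by (simp add: paths_def)
  from dist_inv_set_le[OF assms this, of p] show ?thesis by simp
qed

text \<open>\<open>enn2real\<close> loses nothing here, since \<open>dist_eq\<close> shows that the
  distance is finite.\<close>

definition d :: "'v \<Rightarrow> real" where
  "d v = enn2real (dist_inv_set p b v V0)"

definition D :: "'v \<Rightarrow> real" where
  "D v = d v powr (p - 1)"

lemma D_nonneg: "D v \<ge> 0"
  by (simp add: D_def)

lemma D_V0: "v \<in> V0 \<Longrightarrow> D v = 0"
  using p by (simp add: D_def d_def dist_eq_0)

lemma m_summable: "m summable_on A"
proof -
  have "m summable_on UNIV"
    using vol_finite infsum_ennreal_finite_iff[of UNIV m] by (simp add: vol_def less_imp_le[OF m_pos])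
  then show ?thesis by (rule summable_on_subset_banach) simp
qed

definition \<mu> :: real where
  "\<mu> = (\<Sum>\<^sub>\<infinity>v\<in>-V0. m v)"

lemma vol_eq: "vol m (- V0) = ennreal \<mu>"
  unfolding vol_def \<mu>_def using m_pos less_imp_le by (intro infsum_ennreal_eq m_summable) blast

lemma m_le_\<mu>: "v \<notin> V0 \<Longrightarrow> m v \<le> \<mu>"
  unfolding \<mu>_def using finite_sum_le_infsum[OF m_summable, of "{v}" "- V0"]
  by (simp add: less_imp_le[OF m_pos])

lemma \<mu>_pos: "\<mu> > 0"
proof -
  obtain v where "v \<notin> V0" using V0_proper by blast
  then show ?thesis using m_le_\<mu>[of v] m_pos[of v] by linarith
qed

lemma dist_sum_finite: "(\<Sum>\<^sub>\<infinity>v\<in>-V0. ennpowr (dist_inv_set p b v V0) (p - 1) * ennreal (m v)) < \<infinity>"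
proof -
  \<comment> \<open>The volume is finite, so the prefactor cannot hide an infinite sum through
    \<open>0 * \<infinity> = 0\<close>.\<close>
  have "1 / vol m (- V0) \<noteq> 0" by (simp add: vol_eq)
  then show ?thesis
    using Mean_finite unfolding Mean_inv_def by (auto simp: ennreal_mult_less_top ennreal_mult_eq_top_iff less_top)
qed

text \<open>Vertices have positive mass, so a single infinite distance off \<open>V0\<close> would
  already make the weighted sum infinite.\<close>

lemma dist_eq: "dist_inv_set p b v V0 = ennreal (d v)"
proof (cases "v \<in> V0")
  case True
  then show ?thesis by (simp add: dist_eq_0 d_def)
next
  case False
  let ?f = "\<lambda>v. ennpowr (dist_inv_set p b v V0) (p - 1) * ennreal (m v)"
  have "infsum ?f {v} \<le> infsum ?f (- V0)"
    using False by (intro infsum_mono_neutral nonneg_summable_on_complete) auto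
  then have "?f v < \<infinity>" using dist_sum_finite by (auto simp: less_top[symmetric] top_unique)
  then have "dist_inv_set p b v V0 \<noteq> \<infinity>"
    using m_pos[of v] by (auto simp: ennpowr_def ennreal_mult_less_top)
  then show ?thesis by (simp add: d_def less_top)
qed

lemma d_nonneg: "d v \<ge> 0"
  by (simp add: d_def)

lemma ennpowr_dist: "ennpowr (dist_inv_set p b v V0) (p - 1) = ennreal (D v)"
  by (simp add: dist_eq ennpowr_ennreal D_def d_nonneg)

lemma Dm_summable: "(\<lambda>v. D v * m v) summable_on (- V0)"
proof -
  have "(\<Sum>\<^sub>\<infinity>v\<in>-V0. ennreal (D v * m v)) < \<infinity>"
    using dist_sum_finite by (simp add: ennpowr_dist ennreal_mult' D_nonneg less_imp_le[OF m_pos])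
  then show ?thesis
    using D_nonneg m_pos by (subst (asm) infsum_ennreal_finite_iff) (auto simp: less_imp_le)
qed

definition dist_mean :: real where
  "dist_mean = (\<Sum>\<^sub>\<infinity>v\<in>-V0. D v * m v) / \<mu>"

lemma dist_sum_eq: "(\<Sum>\<^sub>\<infinity>v\<in>-V0. D v * m v) = \<mu> * dist_mean"
  using \<mu>_pos by (simp add: dist_mean_def)

lemma ennreal_dist_sum_eq:
  "(\<Sum>\<^sub>\<infinity>v\<in>-V0. ennpowr (dist_inv_set p b v V0) (p - 1) * ennreal (m v)) = ennreal (\<mu> * dist_mean)"
proof -
  have "(\<Sum>\<^sub>\<infinity>v\<in>-V0. ennreal (D v * m v)) = ennreal (\<mu> * dist_mean)"
    unfolding dist_sum_eq[symmetric]
    using D_nonneg m_pos by (intro infsum_ennreal_eq Dm_summable) (simp add: less_imp_le)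
  then show ?thesis by (simp add: ennpowr_dist ennreal_mult' D_nonneg less_imp_le[OF m_pos])
qed

text \<open>The weighted degree is finite and dominates each incident weight, which keeps the
  lengths of the edges at \<open>v\<close> away from 0.\<close>

lemma edge_len_ge:
  assumes "b v y > 0"
  shows "0 < (\<Sum>\<^sub>\<infinity>w. b v w) powr (- (1 / (p - 1)))" "(\<Sum>\<^sub>\<infinity>w. b v w) powr (- (1 / (p - 1))) \<le> len v y"
proof -
  have "b v y \<le> (\<Sum>\<^sub>\<infinity>w. b v w)"
    using finite_sum_le_infsum[OF b_summable, of "{y}" v] by (simp add: b_nonneg)
  then show "0 < (\<Sum>\<^sub>\<infinity>w. b v w) powr (- (1 / (p - 1)))" "(\<Sum>\<^sub>\<infinity>w. b v w) powr (- (1 / (p - 1))) \<le> len v y"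
    using assms p by (auto intro!: powr_mono2')
qed

lemma path_shorter_than:
  assumes "d v < r"
  obtains w xs where "w \<in> V0" "xs \<in> paths b v w" "path_sum len xs < r"
proof -
  have "\<not> ennreal r \<le> dist_inv_set p b v V0"
    using assms d_nonneg[of v] by (simp add: dist_eq ennreal_le_iff2)
  then show thesis using dist_inv_set_greatest[of V0 b v r p] that by force
qed

lemma d_le_path_sum:
  assumes "w \<in> V0" "xs \<in> paths b v w"
  shows "d v \<le> path_sum len xs"
  using dist_inv_set_le[OF assms, of p] path_sum_nonneg[of len xs] by (simp add: dist_eq)

lemma d_pos:
  assumes "v \<notin> V0"
  shows "d v > 0"
proof (rule ccontr)
  let ?B = "(\<Sum>\<^sub>\<infinity>w. b v w) powr (- (1 / (p - 1)))"
  assume "\<not> d v > 0"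
  then have d0: "d v = 0" using d_nonneg[of v] by simp
  have path: "\<exists>y. b v y > 0 \<and> len v y \<le> path_sum len xs" if w: "w \<in> V0" and xs: "xs \<in> paths b v w" for w xs
  proof -
    have "v \<noteq> w" using assms w by auto
    then obtain y ys where "xs = v # y # ys" "b v y > 0" using paths_Cons[OF xs] by metis
    then show ?thesis using path_sum_nonneg[of len "y # ys"] by auto
  qed
  \<comment> \<open>At an isolated vertex \<open>?B\<close> would be \<open>0 powr a = 0\<close>. A
    first path provides an edge and thereby \<open>?B > 0\<close>; a second path shorter than
    \<open>?B\<close> is then contradictory.\<close>
  obtain w xs where "w \<in> V0" "xs \<in> paths b v w" "path_sum len xs < 1"
    using path_shorter_than[of v 1] d0 by auto
  then obtain y where "b v y > 0" using path by blast
  then have "?B > 0" by (rule edge_len_ge)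
  then obtain w xs where "w \<in> V0" "xs \<in> paths b v w" "path_sum len xs < ?B"
    using path_shorter_than[of v ?B] d0 by auto
  then show False using path[of w xs] edge_len_ge(2)[of v] by fastforce
qed

lemma D_pos: "v \<notin> V0 \<Longrightarrow> D v > 0"
  using d_pos[of v] by (simp add: D_def)

lemma dist_mean_pos: "dist_mean > 0"
proof -
  obtain v where v: "v \<notin> V0" using V0_proper by blast
  have "0 < D v * m v" using D_pos[OF v] m_pos by simp
  also have "\<dots> \<le> (\<Sum>\<^sub>\<infinity>v\<in>-V0. D v * m v)"
    using finite_sum_le_infsum[OF Dm_summable, of "{v}"] v
    by (simp add: D_nonneg less_imp_le[OF m_pos])
  finally show ?thesis using \<mu>_pos by (simp add: dist_mean_def)
qed

lemma Mean_eq: "Mean_inv p m b V0 = ennreal dist_mean"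
proof -
  have "1 / vol m (- V0) = ennreal (1 / \<mu>)"
    using \<mu>_pos divide_ennreal[of 1 \<mu>] by (simp add: vol_eq)
  then show ?thesis
    unfolding Mean_inv_def ennreal_dist_sum_eq
    using \<mu>_pos dist_mean_pos by (simp flip: ennreal_mult')
qed

section \<open>Energy bounds along paths\<close>

text \<open>
  Hoelder's inequality along a path in the form of Young's inequality with a free parameter: it is
  affine in the path length, so it survives the infimum over paths before \<open>\<sigma>\<close> is optimised.
\<close>

lemma path_energy_bound:
  assumes u: "u \<in> finite_energy" and w: "w \<in> V0" and xs: "xs \<in> paths b v w" and \<sigma>: "\<sigma> > 0"
  shows "\<sigma> powr (p - 1) * \<bar>u v\<bar> \<le> p_energy u / p + (1 - 1 / p) * \<sigma> powr p * path_sum len xs"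
proof -
  obtain ys where ys: "ys \<in> paths b v w" "distinct ys" "path_sum len ys \<le> path_sum len xs"
    using simple_path_exists[OF xs, of len] by auto
  let ?g = "\<lambda>x y. b x y * \<bar>u x - u y\<bar> powr p"
  have edge: "\<sigma> powr (p - 1) * \<bar>u x - u y\<bar> \<le> (1 / p) * ?g x y + ((1 - 1 / p) * \<sigma> powr p) * len x y"
    if b: "b x y > 0" for x y
  proof -
    \<comment> \<open>With this \<open>?s\<close> in Young's inequality,
      \<open>b x y * ?s powr (p - 1)\<close> no longer depends on the edge and
      \<open>b x y * ?s powr p\<close> is proportional to its length.\<close>
    let ?s = "\<sigma> * len x y"
    have l: "len x y powr (p - 1) = 1 / b x y"
      unfolding powr_powr using b p by (simp add: powr_minus_divide)
    have "?s powr (p - 1) = \<sigma> powr (p - 1) * len x y powr (p - 1)"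
      by (rule powr_mult)
    then have 1: "b x y * ?s powr (p - 1) = \<sigma> powr (p - 1)" using b unfolding l by simp
    have "?s powr p = \<sigma> powr p * len x y powr (p - 1 + 1)"
      by (subst powr_mult) auto
    also have "len x y powr (p - 1 + 1) = len x y powr (p - 1) * len x y"
      using b by (subst powr_add) simp
    finally have 2: "b x y * ?s powr p = \<sigma> powr p * len x y"
      using b unfolding l by simp
    have "b x y * (?s powr (p - 1) * \<bar>u x - u y\<bar>)
        \<le> b x y * (\<bar>u x - u y\<bar> powr p / p + (1 - 1 / p) * ?s powr p)"
      using b \<sigma> p by (intro mult_left_mono Youngs_inequality_powr) auto
    also have "\<dots> = (1 / p) * ?g x y + (1 - 1 / p) * (b x y * ?s powr p)"
      by (simp add: algebra_simps)
    finally show ?thesis unfolding 2 mult.assoc[symmetric] 1 .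
  qed
  have "u w = 0" using u w by (simp add: finite_energy_def)
  then have "\<bar>u v\<bar> = \<bar>u (hd ys) - u (last ys)\<bar>" using ys(1) by (simp add: paths_def)
  also have "\<dots> \<le> path_sum (\<lambda>x y. \<bar>u x - u y\<bar>) ys"
    using ys(1) by (intro path_sum_triangle) (simp add: paths_def)
  finally have "\<sigma> powr (p - 1) * \<bar>u v\<bar> \<le> \<sigma> powr (p - 1) * path_sum (\<lambda>x y. \<bar>u x - u y\<bar>) ys"
    by (intro mult_left_mono) auto
  also have "\<dots> = path_sum (\<lambda>x y. \<sigma> powr (p - 1) * \<bar>u x - u y\<bar>) ys"
    using path_sum_linear[of "\<sigma> powr (p - 1)" "\<lambda>x y. \<bar>u x - u y\<bar>" 0] by simp
  also have "\<dots> \<le> path_sum (\<lambda>x y. (1 / p) * ?g x y + ((1 - 1 / p) * \<sigma> powr p) * len x y) ys"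
    using ys(1) edge by (intro path_sum_mono[where P = "\<lambda>x y. b x y > 0"]) (auto simp: paths_def)
  also have "\<dots> = (1 / p) * path_sum ?g ys + ((1 - 1 / p) * \<sigma> powr p) * path_sum len ys"
    by (rule path_sum_linear)
  also have "\<dots> \<le> (1 / p) * p_energy u + ((1 - 1 / p) * \<sigma> powr p) * path_sum len xs"
  proof (intro add_mono mult_left_mono)
    \<comment> \<open>Distinctness of \<open>ys\<close> enters here; the division by 2 matches the
      weight \<open>b x y / 2\<close> of ordered pairs.\<close>
    have "path_sum ?g ys \<le> (\<Sum>(x, y)\<in>set ys \<times> set ys. ?g x y) / 2"
      using path_sum_le_sum_Times[OF ys(2), of ?g] b_nonneg b_sym by (simp add: abs_minus_commute)
    also have "\<dots> = (\<Sum>i\<in>Inl ` (set ys \<times> set ys). coeff_at i * \<bar>increment i u\<bar> powr p)"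
      by (subst sum.reindex) (auto simp: coeff_at_def increment_def sum_divide_distrib intro!: sum.cong)
    also have "\<dots> \<le> p_energy u" by (intro sum_le_p_energy u) auto
    finally show "path_sum ?g ys \<le> p_energy u" .
  qed (use ys(3) p in auto)
  finally show ?thesis by simp
qed

lemma pointwise_bound_powr:
  assumes u: "u \<in> finite_energy"
  shows "\<bar>u v\<bar> powr p \<le> D v * p_energy u"
proof (cases "u v = 0")
  case True
  then show ?thesis by (simp add: D_nonneg p_energy_nonneg)
next
  case False
  then have v: "v \<notin> V0" using u by (auto simp: finite_energy_def)
  \<comment> \<open>The optimal parameter for path length \<open>d v\<close>: it turns
    \<open>\<sigma> powr p * d v\<close> into
    \<open>\<sigma> powr (p - 1) * \<bar>u v\<bar>\<close>, so that the two terms merge.\<close>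
  define \<sigma> where "\<sigma> = \<bar>u v\<bar> / d v"
  have \<sigma>: "\<sigma> > 0" using False d_pos[OF v] by (simp add: \<sigma>_def)
  let ?a = "(1 - 1 / p) * \<sigma> powr p"
  \<comment> \<open>\<open>path_energy_bound\<close> solved for the path length; a common lower
    bound for all paths passes to the infimum \<open>d v\<close>. A negative value is harmless,
    since \<open>ennreal\<close> sends it to 0.\<close>
  let ?r = "(\<sigma> powr (p - 1) * \<bar>u v\<bar> - p_energy u / p) / ?a"
  have a: "?a > 0" using p \<sigma> by simp
  have "ennreal ?r \<le> dist_inv_set p b v V0"
  proof (rule dist_inv_set_greatest)
    fix w xs assume "w \<in> V0" "xs \<in> paths b v w"
    from path_energy_bound[OF u this \<sigma>] show "?r \<le> path_sum len xs"
      using a by (simp add: divide_le_eq algebra_simps)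
  qed
  then have "?r \<le> d v" using d_nonneg[of v] by (simp add: dist_eq)
  then have "\<sigma> powr (p - 1) * \<bar>u v\<bar> \<le> p_energy u / p + (1 - 1 / p) * (\<sigma> powr p * d v)"
    using a by (simp add: divide_le_eq algebra_simps)
  also have "\<sigma> powr p * d v = \<sigma> powr (p - 1) * \<bar>u v\<bar>"
    using \<sigma> d_pos[OF v] powr_add[of \<sigma> "p - 1" 1] by (simp add: \<sigma>_def)
  finally have "\<sigma> powr (p - 1) * \<bar>u v\<bar> \<le> p_energy u"
    using p by (simp add: field_simps)
  moreover have "\<sigma> powr (p - 1) * \<bar>u v\<bar> = \<bar>u v\<bar> powr p / D v"
    using False d_pos[OF v] powr_add[of "\<bar>u v\<bar>" "p - 1" 1] by (simp add: \<sigma>_def D_def powr_divide)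
  ultimately show ?thesis using D_pos[OF v] by (simp add: divide_le_eq mult.commute)
qed

lemma pointwise_bound:
  assumes "u \<in> finite_energy"
  shows "\<bar>u v\<bar> \<le> D v powr (1 / p) * p_energy u powr (1 / p)"
proof -
  have "\<bar>u v\<bar> = (\<bar>u v\<bar> powr p) powr (1 / p)" using p by (simp add: powr_powr)
  also have "\<dots> \<le> (D v * p_energy u) powr (1 / p)"
    using p by (intro powr_mono2 pointwise_bound_powr assms) auto
  finally show ?thesis using D_nonneg p_energy_nonneg by (simp add: powr_mult)
qed

text \<open>The tangent bound dominates the root by an affine function of \<open>D v\<close>; the
  total mass and the weighted sum of \<open>D\<close> are both finite.\<close>

lemma D_root_summable: "(\<lambda>v. D v powr (1 / p) * m v) summable_on (- V0)"
proof (rule summable_on_comparison_test)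
  show "(\<lambda>v. (1 - 1 / p) * m v + (1 / p) * (D v * m v)) summable_on (- V0)"
    by (intro summable_on_add summable_on_cmult_right m_summable Dm_summable)
  show "D v powr (1 / p) * m v \<le> (1 - 1 / p) * m v + (1 / p) * (D v * m v)" for v
    using mult_right_mono[OF powr_inverse_le[OF p D_nonneg[of v]], of "m v"] m_pos[of v]
    by (simp add: algebra_simps diff_divide_distrib)
qed (simp add: less_imp_le[OF m_pos])

section \<open>The graph energy as an abstract p-energy\<close>

sublocale form: p_energy_form p coeff_at increment m "\<lambda>v. D v powr (1 / p)" V0
proof
  show "continuous_on UNIV (increment i)" for i
  proof (cases i)
    case (Inl a)
    then show ?thesis
      by (cases a) (auto simp: increment_def[abs_def] intro!: continuous_intros)
  qed (simp add: increment_def[abs_def])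
  show "increment i (\<lambda>v. s * u v + t * h v) = s * increment i u + t * increment i h" for i s u t h
    by (auto simp: increment_def algebra_simps split: sum.split prod.split)
  show "(\<lambda>v. D v powr (1 / p) * m v) summable_on UNIV"
    using D_root_summable by (rule summable_on_cong_neutral[THEN iffD1, rotated -1]) (auto simp: D_V0)
  fix u v assume "(\<lambda>i. coeff_at i * \<bar>increment i u\<bar> powr p) summable_on UNIV" "\<And>v. v \<in> V0 \<Longrightarrow> u v = 0"
  then have "u \<in> finite_energy" by (simp add: finite_energy_def)
  then show "\<bar>u v\<bar> \<le> D v powr (1 / p) * (\<Sum>\<^sub>\<infinity>i. coeff_at i * \<bar>increment i u\<bar> powr p) powr (1 / p)"
    using pointwise_bound by (simp add: p_energy_def)
qed (use p coeff_at_nonneg m_pos in \<open>auto simp: less_imp_le\<close>)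

lemma form_X: "form.X = finite_energy"
  by (simp add: form.X_def finite_energy_def)

lemma form_E: "form.E = p_energy"
  by (simp add: form.E_def p_energy_def fun_eq_iff)

lemma
  shows energy_finite_iff: "energy p b c u < \<infinity> \<longleftrightarrow> (\<lambda>i. coeff_at i * \<bar>increment i u\<bar> powr p) summable_on UNIV"
    and energy_eq: "u \<in> finite_energy \<Longrightarrow> energy p b c u = ennreal (p_energy u / p)"
proof -
  let ?f = "\<lambda>(v, w). b v w * \<bar>u v - u w\<bar> powr p" and ?g = "\<lambda>v. c v * \<bar>u v\<bar> powr p"
  let ?h = "\<lambda>i. coeff_at i * \<bar>increment i u\<bar> powr p"
  have f_nonneg: "?f x \<ge> 0" for x by (auto simp: b_nonneg split: prod.split)
  have g_nonneg: "?g x \<ge> 0" for x by (simp add: c_nonneg)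
  have hf: "?h (Inl x) = 1 / 2 * ?f x" and hg: "?h (Inr y) = ?g y" for x y
    by (auto simp: coeff_at_def increment_def split: prod.split)
  have sum_iff: "?h summable_on UNIV \<longleftrightarrow> ?f summable_on UNIV \<and> ?g summable_on UNIV"
    unfolding summable_on_sum_type_iff hf hg by (subst summable_on_cmult_right') simp_all
  have e: "energy p b c u = ennreal (1 / (2 * p)) * (\<Sum>\<^sub>\<infinity>x. ennreal (?f x)) + ennreal (1 / p) * (\<Sum>\<^sub>\<infinity>x. ennreal (?g x))"
    by (simp add: energy_def case_prod_beta')
  show "energy p b c u < \<infinity> \<longleftrightarrow> ?h summable_on UNIV"
    unfolding sum_iff e using p infsum_ennreal_finite_iff[of UNIV ?f, OF f_nonneg] infsum_ennreal_finite_iff[of UNIV ?g, OF g_nonneg]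
    by (auto simp: ennreal_mult_less_top)
  have combine: "ennreal x * ennreal y + ennreal x' * ennreal y' = ennreal (x * y + x' * y')"
    if "x \<ge> 0" "y \<ge> 0" "x' \<ge> 0" "y' \<ge> 0" for x y x' y' :: real
    using that by (simp add: ennreal_mult)
  assume "u \<in> finite_energy"
  then have fg: "?f summable_on UNIV" "?g summable_on UNIV"
    using sum_iff by (auto simp: finite_energy_def)
  have "p_energy u = 1 / 2 * infsum ?f UNIV + infsum ?g UNIV"
    unfolding p_energy_def using fg
    by (subst infsum_sum_type) (simp_all only: hf hg infsum_cmult_right' summable_on_cmult_right)
  then have "p_energy u / p = 1 / (2 * p) * infsum ?f UNIV + 1 / p * infsum ?g UNIV"
    by (simp add: add_divide_distrib)
  moreover have "infsum ?f UNIV \<ge> 0" "infsum ?g UNIV \<ge> 0"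
    by (auto intro!: infsum_nonneg simp: b_nonneg c_nonneg)
  ultimately show "energy p b c u = ennreal (p_energy u / p)"
    unfolding e infsum_ennreal_eq[OF fg(1) f_nonneg] infsum_ennreal_eq[OF fg(2) g_nonneg]
    using p combine[of "1 / (2 * p)" "infsum ?f UNIV" "1 / p" "infsum ?g UNIV"] by simp
qed

lemma lnorm_1_eq:
  assumes "u \<in> finite_energy"
  shows "lnorm 1 m (- V0) u = ennreal (\<Sum>\<^sub>\<infinity>v\<in>-V0. \<bar>u v\<bar> * m v)"
    and "lnorm 1 m UNIV u < \<infinity>"
proof -
  have s: "(\<lambda>v. \<bar>u v\<bar> * m v) summable_on UNIV"
    using form.load_summable(1)[of u] assms by (simp add: form_X)
  have *: "lnorm 1 m A u = ennreal (\<Sum>\<^sub>\<infinity>v\<in>A. \<bar>u v\<bar> * m v)" for A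
  proof -
    have "(\<Sum>\<^sub>\<infinity>v\<in>A. ennreal (\<bar>u v\<bar> * m v)) = ennreal (\<Sum>\<^sub>\<infinity>v\<in>A. \<bar>u v\<bar> * m v)"
      using summable_on_subset_banach[OF s] m_pos by (intro infsum_ennreal_eq) (auto simp: less_imp_le)
    moreover have "(\<Sum>\<^sub>\<infinity>v\<in>A. \<bar>u v\<bar> * m v) \<ge> 0"
      by (intro infsum_nonneg) (simp add: less_imp_le[OF m_pos])
    ultimately show ?thesis by (simp add: lnorm_def ennpowr_ennreal)
  qed
  show "lnorm 1 m (- V0) u = ennreal (\<Sum>\<^sub>\<infinity>v\<in>-V0. \<bar>u v\<bar> * m v)" by (rule *)
  show "lnorm 1 m UNIV u < \<infinity>" unfolding * by simp
qed

text \<open>Finite energy forces a finite l1 norm: the pointwise bound dominates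
  \<open>\<bar>u v\<bar>\<close> by a multiple of \<open>D v powr (1 / p)\<close>, which is summable
  against \<open>m\<close>.\<close>

lemma sobolev0_1_eq: "sobolev0 p 1 m b c V0 = finite_energy"
  using lnorm_1_eq(2) energy_finite_iff by (auto simp: sobolev0_def finite_energy_def)

lemma sobolev0_p_subset: "sobolev0 p p m b c V0 \<subseteq> finite_energy"
  using energy_finite_iff by (auto simp: sobolev0_def finite_energy_def)

section \<open>Bottom of the spectrum and the Poincare inequality\<close>

lemma p_sum_summable:
  assumes "u \<in> finite_energy"
  shows "(\<lambda>v. \<bar>u v\<bar> powr p * m v) summable_on (- V0)"
    and "(\<Sum>\<^sub>\<infinity>v\<in>-V0. \<bar>u v\<bar> powr p * m v) \<le> \<mu> * dist_mean * p_energy u"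
proof -
  have le: "\<bar>u v\<bar> powr p * m v \<le> p_energy u * (D v * m v)" for v
    using mult_right_mono[OF pointwise_bound_powr[OF assms, of v], of "m v"] m_pos[of v]
    by (simp add: algebra_simps)
  have s: "(\<lambda>v. p_energy u * (D v * m v)) summable_on (- V0)"
    by (intro summable_on_cmult_right Dm_summable)
  show *: "(\<lambda>v. \<bar>u v\<bar> powr p * m v) summable_on (- V0)"
    using le m_pos by (intro summable_on_comparison_test[OF s]) (auto simp: less_imp_le)
  have "(\<Sum>\<^sub>\<infinity>v\<in>-V0. \<bar>u v\<bar> powr p * m v) \<le> (\<Sum>\<^sub>\<infinity>v\<in>-V0. p_energy u * (D v * m v))"
    by (intro infsum_mono * s le)
  also have "\<dots> = \<mu> * dist_mean * p_energy u"
    unfolding infsum_cmult_right' dist_sum_eq by (rule mult.commute)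
  finally show "(\<Sum>\<^sub>\<infinity>v\<in>-V0. \<bar>u v\<bar> powr p * m v) \<le> \<mu> * dist_mean * p_energy u" .
qed

lemma p_sum_nonneg: "(\<Sum>\<^sub>\<infinity>v\<in>-V0. \<bar>u v\<bar> powr p * m v) \<ge> 0"
  by (intro infsum_nonneg) (simp add: less_imp_le[OF m_pos])

lemma lnorm_p_eq:
  assumes "u \<in> finite_energy"
  shows "lnorm p m (- V0) u = ennreal ((\<Sum>\<^sub>\<infinity>v\<in>-V0. \<bar>u v\<bar> powr p * m v) powr (1 / p))"
proof -
  have "(\<Sum>\<^sub>\<infinity>v\<in>-V0. ennreal (\<bar>u v\<bar> powr p * m v)) = ennreal (\<Sum>\<^sub>\<infinity>v\<in>-V0. \<bar>u v\<bar> powr p * m v)"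
    by (intro infsum_ennreal_eq p_sum_summable assms) (simp add: less_imp_le[OF m_pos])
  then show ?thesis by (simp add: lnorm_def ennpowr_ennreal p_sum_nonneg)
qed

lemma p_energy_pos:
  assumes "u \<in> finite_energy" "u \<noteq> (\<lambda>_. 0)"
  shows "p_energy u > 0"
  using form.E_eq_0_imp[of u] assms p_energy_nonneg[of u] by (force simp: form_X form_E)

lemma bottom_spectrum_ge: "1 / (vol m (- V0) * Mean_inv p m b V0) \<le> bottom_spectrum p m b c V0"
  unfolding bottom_spectrum_def
proof (rule INF_greatest)
  fix u assume "u \<in> sobolev0 p p m b c V0 - {\<lambda>_. 0}"
  then have u: "u \<in> finite_energy" "u \<noteq> (\<lambda>_. 0)" using sobolev0_p_subset by auto
  define R where "R = (\<Sum>\<^sub>\<infinity>v\<in>-V0. \<bar>u v\<bar> powr p * m v)"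
  have R_le: "R \<le> \<mu> * dist_mean * p_energy u" unfolding R_def by (rule p_sum_summable(2)[OF u(1)])
  \<comment> \<open>A nonzero function vanishing on \<open>V0\<close> is nonzero at some vertex off
    \<open>V0\<close>, whose mass is positive; hence the quotient has a positive
    denominator.\<close>
  obtain v where v: "u v \<noteq> 0" using u(2) by auto
  then have "v \<notin> V0" using u(1) by (auto simp: finite_energy_def)
  have "0 < \<bar>u v\<bar> powr p * m v" using v m_pos by simp
  also have "\<dots> \<le> R"
    unfolding R_def using finite_sum_le_infsum[OF p_sum_summable(1)[OF u(1)], of "{v}"] \<open>v \<notin> V0\<close>
    by (simp add: less_imp_le[OF m_pos])
  finally have R: "R > 0" .
  have "ennpowr (lnorm p m (- V0) u) p = ennreal R"
    using R p by (simp add: lnorm_p_eq[OF u(1)] ennpowr_ennreal powr_powr flip: R_def)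
  moreover have "ennreal p * energy p b c u = ennreal (p_energy u)"
    using p p_energy_nonneg[of u] by (simp add: energy_eq[OF u(1)] flip: ennreal_mult')
  moreover have "1 / (vol m (- V0) * Mean_inv p m b V0) = ennreal (1 / (\<mu> * dist_mean))"
    using \<mu>_pos dist_mean_pos divide_ennreal[of 1 "\<mu> * dist_mean"]
    by (simp add: vol_eq Mean_eq ennreal_mult'[symmetric])
  moreover have "1 / (\<mu> * dist_mean) \<le> p_energy u / R"
    using R_le R \<mu>_pos dist_mean_pos by (simp add: field_simps)
  ultimately show "1 / (vol m (- V0) * Mean_inv p m b V0)
      \<le> ennreal p * energy p b c u / ennpowr (lnorm p m (- V0) u) p"
    using R p_energy_nonneg[of u] by (simp add: divide_ennreal ennreal_leI)
qed

lemma Mean_le_Inr: "Mean_inv p m b V0 \<le> Inr_inv p b V0"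
proof (cases "Inr_inv p b V0 = \<infinity>")
  case False
  then obtain R where R: "R \<ge> 0" "Inr_inv p b V0 = ennreal R"
    by (cases "Inr_inv p b V0" rule: ennreal_cases) auto
  have D_le: "D v \<le> R" for v
  proof -
    have "ennreal (D v) \<le> ennreal R"
      unfolding ennpowr_dist[symmetric] R(2)[symmetric] Inr_inv_def by (intro SUP_upper) simp
    then show ?thesis using R(1) by simp
  qed
  have "\<mu> * dist_mean \<le> (\<Sum>\<^sub>\<infinity>v\<in>-V0. R * m v)"
    unfolding dist_sum_eq[symmetric] using D_le
    by (intro infsum_mono Dm_summable summable_on_cmult_right m_summable mult_right_mono)
      (auto simp: less_imp_le[OF m_pos])
  also have "\<dots> = \<mu> * R" by (simp add: infsum_cmult_right' \<mu>_def)
  finally have "dist_mean \<le> R" using \<mu>_pos by simp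
  then show ?thesis by (simp add: Mean_eq R(2) ennreal_leI)
qed simp

lemma Poincare_inequality:
  "\<exists>M::real. M > 0 \<and> (\<forall>u \<in> sobolev0 p p m b c V0.
      lnorm p m (- V0) u \<le> ennreal M * ennpowr (energy p b c u) (1 / p))"
proof (intro exI conjI ballI)
  \<comment> \<open>The factor \<open>p\<close> converts \<open>p_energy\<close> back to the
    energy.\<close>
  let ?M = "(\<mu> * dist_mean * p) powr (1 / p)"
  show "?M > 0" using \<mu>_pos dist_mean_pos p by simp
  fix u assume "u \<in> sobolev0 p p m b c V0"
  then have u: "u \<in> finite_energy" using sobolev0_p_subset by auto
  have "(\<Sum>\<^sub>\<infinity>v\<in>-V0. \<bar>u v\<bar> powr p * m v) powr (1 / p) \<le> (\<mu> * dist_mean * p_energy u) powr (1 / p)"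
    using p by (intro powr_mono2 p_sum_summable u p_sum_nonneg) auto
  also have "\<mu> * dist_mean * p_energy u = (\<mu> * dist_mean * p) * (p_energy u / p)"
    using p by simp
  also have "\<dots> powr (1 / p) = ?M * (p_energy u / p) powr (1 / p)" by (rule powr_mult)
  finally show "lnorm p m (- V0) u \<le> ennreal ?M * ennpowr (energy p b c u) (1 / p)"
    using p p_energy_nonneg[of u] unfolding lnorm_p_eq[OF u] energy_eq[OF u]
    by (simp add: ennpowr_ennreal ennreal_leI flip: ennreal_mult')
qed

section \<open>Upper bounds for the torsional rigidity\<close>

text \<open>An l1 estimate with one constant for all \<open>u\<close> survives the supremum. A
  strict bound on the torsional rigidity thus reduces to such an estimate with a smaller
  constant.\<close>

lemma torsional_rigidity_le:
  assumes "\<kappa> \<ge> 0"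
    and "\<And>u. u \<in> finite_energy \<Longrightarrow> (\<Sum>\<^sub>\<infinity>v\<in>-V0. \<bar>u v\<bar> * m v) \<le> \<kappa> * p_energy u powr (1 / p)"
  shows "torsional_rigidity p m b c V0 \<le> ennreal (\<kappa> powr p)"
  unfolding torsional_rigidity_def sobolev0_1_eq
proof (rule SUP_least)
  fix u assume "u \<in> finite_energy - {\<lambda>_. 0}"
  then have u: "u \<in> finite_energy" and E: "p_energy u > 0" using p_energy_pos by auto
  define N where "N = (\<Sum>\<^sub>\<infinity>v\<in>-V0. \<bar>u v\<bar> * m v)"
  have N: "N \<ge> 0" unfolding N_def by (intro infsum_nonneg) (simp add: less_imp_le[OF m_pos])
  have "N powr p \<le> (\<kappa> * p_energy u powr (1 / p)) powr p"
    using p N assms(2)[OF u] by (intro powr_mono2) (auto simp: N_def)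
  also have "\<dots> = \<kappa> powr p * p_energy u" using p E by (simp add: powr_mult powr_powr)
  finally have "N powr p / p_energy u \<le> \<kappa> powr p" using E by (simp add: divide_le_eq)
  moreover have "ennreal p * energy p b c u = ennreal (p_energy u)"
    using p p_energy_nonneg[of u] by (simp add: energy_eq[OF u] flip: ennreal_mult')
  ultimately show "ennpowr (lnorm 1 m (- V0) u) p / (ennreal p * energy p b c u) \<le> ennreal (\<kappa> powr p)"
    using E N by (simp add: lnorm_1_eq[OF u] ennpowr_ennreal divide_ennreal ennreal_leI flip: N_def)
qed

lemma vol_powr_mult_Mean:
  "ennpowr (vol m (- V0)) p * Mean_inv p m b V0 = ennreal ((dist_mean powr (1 / p) * \<mu>) powr p)"
  using \<mu>_pos dist_mean_pos p
  by (simp add: vol_eq Mean_eq ennpowr_ennreal powr_mult powr_powr mult.commute flip: ennreal_mult')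

text \<open>The profile \<open>g\<close> is kept general so that the pointwise bound can be improved
  at a single vertex.\<close>

lemma l1_bound:
  assumes "u \<in> finite_energy" "(\<lambda>v. g v * m v) summable_on (- V0)"
    and "\<And>v. v \<notin> V0 \<Longrightarrow> \<bar>u v\<bar> \<le> g v * p_energy u powr (1 / p)"
  shows "(\<Sum>\<^sub>\<infinity>v\<in>-V0. \<bar>u v\<bar> * m v) \<le> (\<Sum>\<^sub>\<infinity>v\<in>-V0. g v * m v) * p_energy u powr (1 / p)"
proof -
  have "(\<Sum>\<^sub>\<infinity>v\<in>-V0. \<bar>u v\<bar> * m v) \<le> (\<Sum>\<^sub>\<infinity>v\<in>-V0. p_energy u powr (1 / p) * (g v * m v))"
  proof (rule infsum_mono)
    have "(\<lambda>v. \<bar>u v\<bar> * m v) summable_on UNIV"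
      using form.load_summable(1)[of u] assms by (simp add: form_X)
    then show "(\<lambda>v. \<bar>u v\<bar> * m v) summable_on (- V0)" by (rule summable_on_subset_banach) simp
    show "(\<lambda>v. p_energy u powr (1 / p) * (g v * m v)) summable_on (- V0)"
      by (intro summable_on_cmult_right assms)
    fix v assume "v \<in> - V0"
    then show "\<bar>u v\<bar> * m v \<le> p_energy u powr (1 / p) * (g v * m v)"
      using mult_right_mono[OF assms(3)[of v], of "m v"] m_pos[of v] by (simp add: algebra_simps)
  qed
  then show ?thesis unfolding infsum_cmult_right' by (simp only: mult.commute)
qed

lemma D_root_le: "D v powr (1 / p) \<le> dist_mean powr (1 / p) * (1 + (D v / dist_mean - 1) / p)"
  and D_root_less: "D v \<noteq> dist_mean \<Longrightarrow>
    D v powr (1 / p) < dist_mean powr (1 / p) * (1 + (D v / dist_mean - 1) / p)"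
proof -
  have *: "D v powr (1 / p) = dist_mean powr (1 / p) * (D v / dist_mean) powr (1 / p)"
    using dist_mean_pos by (simp add: powr_divide)
  show "D v powr (1 / p) \<le> dist_mean powr (1 / p) * (1 + (D v / dist_mean - 1) / p)"
    unfolding * using p dist_mean_pos D_nonneg[of v] by (intro mult_left_mono powr_inverse_le) auto
  assume "D v \<noteq> dist_mean"
  then show "D v powr (1 / p) < dist_mean powr (1 / p) * (1 + (D v / dist_mean - 1) / p)"
    unfolding * using p dist_mean_pos D_nonneg[of v]
    by (intro mult_strict_left_mono powr_inverse_less) auto
qed

text \<open>Jensen's inequality for the p-th root: the tangent at \<open>dist_mean\<close> is
  summed, and its linear part cancels because \<open>dist_mean\<close> is the mean of
  \<open>D\<close>. Any vertex with another value of \<open>D\<close> has positive mass and makes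
  the sum strictly smaller.\<close>

lemma
  shows D_root_sum_le: "(\<Sum>\<^sub>\<infinity>v\<in>-V0. D v powr (1 / p) * m v) \<le> dist_mean powr (1 / p) * \<mu>"
    and D_root_sum_less: "v \<notin> V0 \<Longrightarrow> D v \<noteq> dist_mean \<Longrightarrow>
      (\<Sum>\<^sub>\<infinity>v\<in>-V0. D v powr (1 / p) * m v) < dist_mean powr (1 / p) * \<mu>"
proof -
  let ?g = "\<lambda>v. dist_mean powr (1 / p) * (1 + (D v / dist_mean - 1) / p) * m v"
  let ?a = "dist_mean powr (1 / p)"
  have g: "?g v = (?a * (1 - 1 / p)) * m v + (?a / (p * dist_mean)) * (D v * m v)" for v
    using p dist_mean_pos by (simp add: field_simps)
  have s: "?g summable_on (- V0)"
    unfolding g by (intro summable_on_add summable_on_cmult_right m_summable Dm_summable)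
  have "infsum ?g (- V0) = (?a * (1 - 1 / p)) * \<mu> + (?a / (p * dist_mean)) * (\<mu> * dist_mean)"
    unfolding g by (subst infsum_add)
      (intro summable_on_cmult_right m_summable Dm_summable
        | simp only: infsum_cmult_right' dist_sum_eq \<mu>_def[symmetric])+
  also have "\<dots> = ?a * \<mu>" using p dist_mean_pos by (simp add: field_simps)
  finally have sum: "infsum ?g (- V0) = ?a * \<mu>" .
  show "(\<Sum>\<^sub>\<infinity>v\<in>-V0. D v powr (1 / p) * m v) \<le> ?a * \<mu>"
    unfolding sum[symmetric] using m_pos
    by (intro infsum_mono D_root_summable s mult_right_mono D_root_le) (auto simp: less_imp_le)
  assume v: "v \<notin> V0" "D v \<noteq> dist_mean"
  show "(\<Sum>\<^sub>\<infinity>v\<in>-V0. D v powr (1 / p) * m v) < ?a * \<mu>"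
    unfolding sum[symmetric]
  proof (rule has_sum_strict_mono)
    show "((\<lambda>v. D v powr (1 / p) * m v) has_sum (\<Sum>\<^sub>\<infinity>v\<in>-V0. D v powr (1 / p) * m v)) (- V0)"
      using D_root_summable by simp
    show "(?g has_sum infsum ?g (- V0)) (- V0)" using s by simp
    show "D x powr (1 / p) * m x \<le> ?g x" for x
      using m_pos by (intro mult_right_mono D_root_le) (auto simp: less_imp_le)
    show "v \<in> - V0" using v by simp
    show "D v powr (1 / p) * m v < ?g v"
      by (intro mult_strict_right_mono D_root_less m_pos v)
  qed
qed


section \<open>Strictness of the bound for the torsional rigidity\<close>

text \<open>A path whose first edge ends off \<open>V0\<close> exceeds \<open>d v\<close> by at
  least the length of that edge, because the remaining distance is again \<open>d v\<close>. Nearly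
  shortest paths therefore enter \<open>V0\<close> at once. The infimum need not be attained, hence
  \<open>\<beta>\<close> below \<open>1 / A\<close>.\<close>

lemma edge_to_V0:
  assumes const: "\<And>w. w \<notin> V0 \<Longrightarrow> D w = A" and v: "v \<notin> V0" and \<beta>: "0 < \<beta>" "\<beta> < 1 / A"
  obtains y where "y \<in> V0" "b v y > \<beta>"
proof -
  let ?e = "- (1 / (p - 1))"
  have A: "A > 0" using D_pos[OF v] const[OF v] by simp
  have d_const: "d w = A powr (1 / (p - 1))" if "w \<notin> V0" for w
    using const[OF that, symmetric] d_nonneg[of w] p by (simp add: D_def powr_powr)
  have "A powr (1 / (p - 1)) = (1 / A) powr ?e"
    using A by (simp add: powr_divide powr_minus_divide)
  also have "\<dots> < \<beta> powr ?e"
    using \<beta> p by (intro powr_less_mono2_neg) auto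
  finally have d_less: "d v < \<beta> powr ?e" using d_const[OF v] by simp
  have split: "\<exists>y ys. xs = v # y # ys \<and> b v y > 0 \<and> y # ys \<in> paths b y w"
    if "w \<in> V0" and xs: "xs \<in> paths b v w" for w xs
  proof -
    have "v \<noteq> w" using v that by auto
    then show ?thesis using paths_Cons[OF xs] by metis
  qed
  obtain w0 xs0 where "w0 \<in> V0" "xs0 \<in> paths b v w0"
    using path_shorter_than[OF d_less] by metis
  then obtain y0 where "b v y0 > 0" using split by blast
  then have "d v < d v + (\<Sum>\<^sub>\<infinity>w. b v w) powr ?e" using edge_len_ge(1) by simp
  \<comment> \<open>The first bound rules out a second vertex off \<open>V0\<close>; the other one
    makes the first edge heavier than \<open>\<beta>\<close>.\<close>
  then have "d v < min (d v + (\<Sum>\<^sub>\<infinity>w. b v w) powr ?e) (\<beta> powr ?e)" using d_less by simp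
  then obtain w xs where w: "w \<in> V0" and xs: "xs \<in> paths b v w"
    and short: "path_sum len xs < min (d v + (\<Sum>\<^sub>\<infinity>w. b v w) powr ?e) (\<beta> powr ?e)"
    using path_shorter_than by metis
  obtain y ys where y: "xs = v # y # ys" "b v y > 0" "y # ys \<in> paths b y w"
    using split[OF w xs] by blast
  have "y \<in> V0"
  proof (rule ccontr)
    assume "y \<notin> V0"
    then have "d v \<le> path_sum len (y # ys)"
      using d_le_path_sum[OF w y(3)] d_const v by simp
    then show False using short edge_len_ge(2)[OF y(2)] by (simp add: y(1))
  qed
  moreover have "len v y < \<beta> powr ?e"
    using short path_sum_nonneg[of len "y # ys"] by (simp add: y(1))
  then have "\<beta> < b v y"
    using powr_mono2'[of ?e "b v y" \<beta>] y(2) p by (force simp: not_less[symmetric])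
  ultimately show thesis by (rule that)
qed

text \<open>An edge from \<open>v\<close> into \<open>V0\<close> occurs in both orientations, each
  with half its weight, and its increment is \<open>u v\<close> up to sign.\<close>

lemma p_energy_ge_boundary:
  assumes u: "u \<in> finite_energy" and "finite P" "P \<subseteq> (- V0) \<times> V0" "finite F"
  shows "(\<Sum>(v, y)\<in>P. b v y * \<bar>u v\<bar> powr p) + (\<Sum>v\<in>F. c v * \<bar>u v\<bar> powr p) \<le> p_energy u"
proof -
  let ?h = "\<lambda>i. coeff_at i * \<bar>increment i u\<bar> powr p" and ?g = "\<lambda>(v, y). b v y * \<bar>u v\<bar> powr p"
  let ?s = "\<lambda>(v, y). Inl (y, v) :: ('v \<times> 'v) + 'v"
  have "u y = 0" if "y \<in> V0" for y using u that by (simp add: finite_energy_def)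
  then have P: "?h (Inl x) = ?g x / 2" "?h (?s x) = ?g x / 2" if "x \<in> P" for x
    using assms(3) that b_sym by (auto simp: coeff_at_def increment_def)
  have "(\<Sum>x\<in>P. ?g x) + (\<Sum>v\<in>F. c v * \<bar>u v\<bar> powr p)
      = (\<Sum>x\<in>P. ?h (Inl x)) + (\<Sum>x\<in>P. ?h (?s x)) + (\<Sum>v\<in>F. ?h (Inr v))"
    by (simp add: P coeff_at_def[of "Inr _"] increment_def[of "Inr _"] flip: sum.distrib)
  also have "\<dots> = sum ?h (Inl ` P) + sum ?h (?s ` P) + sum ?h (Inr ` F)"
    by (simp add: sum.reindex inj_on_def split_beta prod_eq_iff)
  also have "\<dots> = sum ?h (Inl ` P \<union> ?s ` P \<union> Inr ` F)"
    using assms by (subst sum.union_disjoint; (subst sum.union_disjoint)?; fastforce)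
  also have "\<dots> \<le> p_energy u" using assms by (intro sum_le_p_energy) auto
  finally show ?thesis .
qed

text \<open>The energies of edges from \<open>v1\<close> and \<open>v2\<close> into
  \<open>V0\<close> add up, so one of the two vertices misses the pointwise bound by a fixed factor.
  Which one depends on \<open>u\<close>; the minimum of the masses makes the gain uniform.\<close>

lemma l1_bound_strict_const:
  assumes const: "\<And>w. w \<notin> V0 \<Longrightarrow> D w = dist_mean"
    and v: "v1 \<notin> V0" "v2 \<notin> V0" "v1 \<noteq> v2" and u: "u \<in> finite_energy"
  shows "(\<Sum>\<^sub>\<infinity>v\<in>-V0. \<bar>u v\<bar> * m v)
    \<le> dist_mean powr (1 / p) * (\<mu> - (1 - (2 / 3) powr (1 / p)) * min (m v1) (m v2)) * p_energy u powr (1 / p)"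
proof -
  define \<theta> :: real where "\<theta> = (2 / 3) powr (1 / p)"
  have \<theta>: "\<theta> \<le> 1" unfolding \<theta>_def using p by (intro powr_le1) auto
  \<comment> \<open>Any fraction of \<open>1 / dist_mean\<close> strictly between
    \<open>1 / 2\<close> and 1 would do. With \<open>3 / 4\<close> the smaller of the two values
    \<open>\<bar>u v\<bar> powr p\<close> is at most \<open>2 / 3\<close> of the pointwise
    bound.\<close>
  have \<beta>: "0 < 3 / 4 / dist_mean" "3 / 4 / dist_mean < 1 / dist_mean"
    using dist_mean_pos divide_strict_right_mono[of "3 / 4" 1 dist_mean] by simp_all
  obtain y1 where y1: "y1 \<in> V0" "b v1 y1 > 3 / 4 / dist_mean" using edge_to_V0[OF const v(1) \<beta>] by metis
  obtain y2 where y2: "y2 \<in> V0" "b v2 y2 > 3 / 4 / dist_mean" using edge_to_V0[OF const v(2) \<beta>] by metis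
  have "b v1 y1 * \<bar>u v1\<bar> powr p + b v2 y2 * \<bar>u v2\<bar> powr p \<le> p_energy u"
    using p_energy_ge_boundary[OF u, of "{(v1, y1), (v2, y2)}" "{}"] v y1 y2 by simp
  moreover have "3 / 4 / dist_mean * \<bar>u v1\<bar> powr p \<le> b v1 y1 * \<bar>u v1\<bar> powr p"
    "3 / 4 / dist_mean * \<bar>u v2\<bar> powr p \<le> b v2 y2 * \<bar>u v2\<bar> powr p"
    by (intro mult_right_mono less_imp_le[OF y1(2)] less_imp_le[OF y2(2)] powr_ge_zero)+
  ultimately have "3 / 4 / dist_mean * (\<bar>u v1\<bar> powr p + \<bar>u v2\<bar> powr p) \<le> p_energy u"
    by (simp only: distrib_left)
  then have two: "3 / 4 * (\<bar>u v1\<bar> powr p + \<bar>u v2\<bar> powr p) \<le> dist_mean * p_energy u"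
    using dist_mean_pos by (simp add: divide_le_eq mult_ac)
  obtain w where w: "w \<in> {v1, v2}" "\<bar>u w\<bar> powr p \<le> 2 / 3 * (dist_mean * p_energy u)"
    using two by (cases "\<bar>u v1\<bar> powr p \<le> \<bar>u v2\<bar> powr p") force+
  have "\<bar>u w\<bar> = (\<bar>u w\<bar> powr p) powr (1 / p)" using p by (simp add: powr_powr)
  also have "\<dots> \<le> (2 / 3 * (dist_mean * p_energy u)) powr (1 / p)"
    using w(2) p by (intro powr_mono2) auto
  also have "\<dots> = \<theta> * (dist_mean powr (1 / p) * p_energy u powr (1 / p))"
    unfolding \<theta>_def by (simp only: powr_mult)
  finally have uw: "\<bar>u w\<bar> \<le> \<theta> * dist_mean powr (1 / p) * p_energy u powr (1 / p)" by simp
  \<comment> \<open>The constant profile of the pointwise bound, lowered at \<open>w\<close>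
    alone.\<close>
  let ?g = "\<lambda>v. dist_mean powr (1 / p) - (if v = w then (1 - \<theta>) * dist_mean powr (1 / p) else 0)"
  have w_V0: "w \<notin> V0" using w v by auto
  have "((\<lambda>v. dist_mean powr (1 / p) * m v) has_sum dist_mean powr (1 / p) * \<mu>) (- V0)"
    unfolding \<mu>_def by (intro has_sum_cmult_right has_sum_infsum m_summable)
  moreover have "((\<lambda>v. if v = w then - ((1 - \<theta>) * dist_mean powr (1 / p) * m w) else 0)
      has_sum - ((1 - \<theta>) * dist_mean powr (1 / p) * m w)) (- V0)"
    using w_V0 by (intro has_sum_finite_neutralI[of "{w}"]) auto
  ultimately have "((\<lambda>v. dist_mean powr (1 / p) * m v + (if v = w then - ((1 - \<theta>) * dist_mean powr (1 / p) * m w) else 0))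
      has_sum dist_mean powr (1 / p) * \<mu> + - ((1 - \<theta>) * dist_mean powr (1 / p) * m w)) (- V0)"
    by (rule has_sum_add)
  moreover have "(\<lambda>v. dist_mean powr (1 / p) * m v + (if v = w then - ((1 - \<theta>) * dist_mean powr (1 / p) * m w) else 0))
      = (\<lambda>v. ?g v * m v)"
    by (auto simp: fun_eq_iff algebra_simps)
  moreover have "dist_mean powr (1 / p) * \<mu> + - ((1 - \<theta>) * dist_mean powr (1 / p) * m w)
      = dist_mean powr (1 / p) * (\<mu> - (1 - \<theta>) * m w)"
    by (simp add: algebra_simps)
  ultimately have "((\<lambda>v. ?g v * m v) has_sum dist_mean powr (1 / p) * (\<mu> - (1 - \<theta>) * m w)) (- V0)"
    by (simp only:)
  then have sum: "(\<lambda>v. ?g v * m v) summable_on (- V0)"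
    "(\<Sum>\<^sub>\<infinity>v\<in>-V0. ?g v * m v) = dist_mean powr (1 / p) * (\<mu> - (1 - \<theta>) * m w)"
    by (auto simp: has_sum_iff)
  have "(\<Sum>\<^sub>\<infinity>v\<in>-V0. \<bar>u v\<bar> * m v) \<le> (\<Sum>\<^sub>\<infinity>v\<in>-V0. ?g v * m v) * p_energy u powr (1 / p)"
  proof (intro l1_bound u sum)
    fix v assume "v \<notin> V0"
    then show "\<bar>u v\<bar> \<le> ?g v * p_energy u powr (1 / p)"
      using uw pointwise_bound[OF u, of v] const[of v] by (auto simp: algebra_simps)
  qed
  also have "\<dots> \<le> dist_mean powr (1 / p) * (\<mu> - (1 - \<theta>) * min (m v1) (m v2)) * p_energy u powr (1 / p)"
    unfolding sum(2) using w(1) \<theta> by (intro mult_right_mono mult_left_mono diff_left_mono) auto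
  finally show ?thesis unfolding \<theta>_def .
qed

text \<open>A potential at \<open>v\<close> or a second edge contributes a fixed amount of energy on
  top of an edge of weight close to \<open>1 / dist_mean\<close>.\<close>

lemma single_vertex_energy_gap:
  assumes v: "- V0 = {v}" and "\<not> single_edge_graph b c V0"
  obtains \<eta> where "\<eta> > 0" "\<And>u. u \<in> finite_energy \<Longrightarrow> (1 / dist_mean + \<eta>) * \<bar>u v\<bar> powr p \<le> p_energy u"
proof -
  have V0_iff: "x \<in> V0 \<longleftrightarrow> x \<noteq> v" for x using v by auto
  have "dist_mean = D v" using \<mu>_pos m_pos[of v] by (simp add: dist_mean_def \<mu>_def v)
  then have const: "D w = dist_mean" if "w \<notin> V0" for w using that V0_iff by simp
  have edge: "\<exists>y\<in>V0. b v y > \<beta>" if \<beta>: "\<beta> < 1 / dist_mean" for \<beta>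
  proof -
    have "0 < 1 / dist_mean / 2" "1 / dist_mean / 2 < 1 / dist_mean"
      using dist_mean_pos by (simp_all add: field_simps)
    \<comment> \<open>The number \<open>\<beta>\<close> may be negative; the maximum supplies the
      positivity that \<open>edge_to_V0\<close> asks for.\<close>
    then have "0 < max \<beta> (1 / dist_mean / 2)" "max \<beta> (1 / dist_mean / 2) < 1 / dist_mean"
      using \<beta> by (simp_all only: max_less_iff_conj less_max_iff_disj simp_thms)
    then obtain y where "y \<in> V0" "b v y > max \<beta> (1 / dist_mean / 2)"
      using edge_to_V0[OF const, of v] V0_iff by metis
    then show ?thesis by auto
  qed
  have "\<exists>\<eta>0>0. \<forall>y\<in>V0. \<forall>u\<in>finite_energy. (b v y + \<eta>0) * \<bar>u v\<bar> powr p \<le> p_energy u"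
  proof (cases "c v = 0")
    case False
    then have "c v > 0" using c_nonneg[of v] by simp
    moreover have "(b v y + c v) * \<bar>u v\<bar> powr p \<le> p_energy u" if "y \<in> V0" "u \<in> finite_energy" for y u
      using p_energy_ge_boundary[of u "{(v, y)}" "{v}"] that V0_iff by (simp add: distrib_right)
    ultimately show ?thesis by blast
  next
    case True
    obtain y0 where y0: "y0 \<in> V0" "b v y0 > 0" using edge[of 0] dist_mean_pos by auto
    have "{x. b v x > 0} \<noteq> {y0}" using assms True unfolding single_edge_graph_def by blast
    then obtain y1 where y1: "y1 \<noteq> y0" "b v y1 > 0" using y0 by blast
    then have y1_V0: "y1 \<in> V0" using V0_iff b_diag by fastforce
    have "(b v y + min (b v y0) (b v y1)) * \<bar>u v\<bar> powr p \<le> p_energy u"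
      if y: "y \<in> V0" and u: "u \<in> finite_energy" for y u
    proof -
      \<comment> \<open>The given \<open>y\<close> may coincide with \<open>y0\<close> or
        \<open>y1\<close>; the other one then supplies the additional edge.\<close>
      obtain z where z: "z \<in> {y0, y1}" "z \<noteq> y" using y1(1) by blast
      have "(b v y + min (b v y0) (b v y1)) * \<bar>u v\<bar> powr p \<le> (b v y + b v z) * \<bar>u v\<bar> powr p"
        using z(1) by (intro mult_right_mono) auto
      also have "\<dots> \<le> p_energy u"
        using p_energy_ge_boundary[OF u, of "{(v, y), (v, z)}" "{}"] z y y0(1) y1_V0 V0_iff
        by (auto simp: distrib_right)
      finally show ?thesis .
    qed
    then show ?thesis using y0(2) y1(2) by (intro exI[of _ "min (b v y0) (b v y1)"]) auto
  qed
  then obtain \<eta>0 where \<eta>0: "\<eta>0 > 0"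
    and le: "\<And>y u. y \<in> V0 \<Longrightarrow> u \<in> finite_energy \<Longrightarrow> (b v y + \<eta>0) * \<bar>u v\<bar> powr p \<le> p_energy u"
    by blast
  \<comment> \<open>An edge whose weight is short of \<open>1 / dist_mean\<close> by less than
    \<open>\<eta>0 / 2\<close> leaves half of the gap.\<close>
  obtain y where y: "y \<in> V0" "b v y > 1 / dist_mean - \<eta>0 / 2" using edge[of "1 / dist_mean - \<eta>0 / 2"] \<eta>0 by auto
  show thesis
  proof
    show "\<eta>0 / 2 > 0" using \<eta>0 by simp
    fix u assume u: "u \<in> finite_energy"
    have "(1 / dist_mean + \<eta>0 / 2) * \<bar>u v\<bar> powr p \<le> (b v y + \<eta>0) * \<bar>u v\<bar> powr p"
      using y(2) by (intro mult_right_mono) auto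
    then show "(1 / dist_mean + \<eta>0 / 2) * \<bar>u v\<bar> powr p \<le> p_energy u" using le[OF y(1) u] by linarith
  qed
qed

lemma strict_l1_bound:
  assumes "\<not> single_edge_graph b c V0"
  obtains \<kappa> where "0 \<le> \<kappa>" "\<kappa> < dist_mean powr (1 / p) * \<mu>"
    "\<And>u. u \<in> finite_energy \<Longrightarrow> (\<Sum>\<^sub>\<infinity>v\<in>-V0. \<bar>u v\<bar> * m v) \<le> \<kappa> * p_energy u powr (1 / p)"
proof -
  \<comment> \<open>Strict concavity of the root settles the first case and competition for the
    energy the second. The third is the one that draws on the hypothesis about
    \<open>single_edge_graph\<close>.\<close>
  consider v where "v \<notin> V0" "D v \<noteq> dist_mean"
    | v1 v2 where "\<And>w. w \<notin> V0 \<Longrightarrow> D w = dist_mean" "v1 \<notin> V0" "v2 \<notin> V0" "v1 \<noteq> v2"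
    | v where "- V0 = {v}"
    using V0_proper by blast
  then show thesis
  proof cases
    case 1
    show thesis
    proof (rule that)
      show "(\<Sum>\<^sub>\<infinity>v\<in>-V0. D v powr (1 / p) * m v) \<ge> 0"
        by (intro infsum_nonneg) (simp add: less_imp_le[OF m_pos])
    qed (use 1 in \<open>auto intro: D_root_sum_less l1_bound D_root_summable pointwise_bound\<close>)
  next
    case 2
    let ?x = "(1 - (2 / 3) powr (1 / p)) * min (m v1) (m v2)"
    have "(2 / 3 :: real) powr (1 / p) < 1" using p powr_less_mono2[of "1 / p" "2 / 3" 1] by simp
    then have "0 < ?x" using m_pos[of v1] m_pos[of v2] by (intro mult_pos_pos) auto
    moreover have "?x \<le> 1 * min (m v1) (m v2)"
      using m_pos[of v1] m_pos[of v2] by (intro mult_right_mono) auto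
    then have "?x \<le> \<mu>" using m_le_\<mu>[OF 2(2)] by simp
    ultimately show thesis
      using dist_mean_pos l1_bound_strict_const[OF 2]
      by (intro that[of "dist_mean powr (1 / p) * (\<mu> - ?x)"]) auto
  next
    case 3
    obtain \<eta> where \<eta>: "\<eta> > 0" "\<And>u. u \<in> finite_energy \<Longrightarrow> (1 / dist_mean + \<eta>) * \<bar>u v\<bar> powr p \<le> p_energy u"
      using single_vertex_energy_gap[OF 3 assms] by blast
    \<comment> \<open>Takes the place of \<open>dist_mean\<close> in the pointwise bound; the gap
      \<open>\<eta>\<close> makes it strictly smaller.\<close>
    define A where "A = 1 / (1 / dist_mean + \<eta>)"
    have q: "1 / dist_mean + \<eta> > 0" using \<eta>(1) dist_mean_pos by (simp add: add_pos_pos)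
    then have A: "0 < A" "A < dist_mean"
      using \<eta>(1) dist_mean_pos by (simp_all add: A_def divide_less_eq distrib_left)
    have \<mu>: "\<mu> = m v" by (simp add: \<mu>_def 3)
    show thesis
    proof (rule that)
      show "0 \<le> A powr (1 / p) * \<mu>" using \<mu>_pos by simp
      show "A powr (1 / p) * \<mu> < dist_mean powr (1 / p) * \<mu>"
        using A p \<mu>_pos by (intro mult_strict_right_mono powr_less_mono2) auto
      fix u assume u: "u \<in> finite_energy"
      have "\<bar>u v\<bar> powr p \<le> A * p_energy u"
        using \<eta>(2)[OF u] q by (simp add: A_def pos_le_divide_eq mult.commute)
      then have "(\<bar>u v\<bar> powr p) powr (1 / p) \<le> (A * p_energy u) powr (1 / p)"
        using p by (intro powr_mono2) auto
      then have "\<bar>u v\<bar> \<le> A powr (1 / p) * p_energy u powr (1 / p)"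
        using p by (simp add: powr_powr powr_mult)
      then show "(\<Sum>\<^sub>\<infinity>v\<in>-V0. \<bar>u v\<bar> * m v) \<le> A powr (1 / p) * \<mu> * p_energy u powr (1 / p)"
        using mult_right_mono[of _ _ "m v"] m_pos[of v] by (simp add: 3 \<mu> algebra_simps)
    qed
  qed
qed

lemma torsional_rigidity_le_Mean:
  "torsional_rigidity p m b c V0 \<le> ennpowr (vol m (- V0)) p * Mean_inv p m b V0"
  unfolding vol_powr_mult_Mean
proof (rule torsional_rigidity_le)
  show "0 \<le> dist_mean powr (1 / p) * \<mu>" using \<mu>_pos by simp
  fix u assume u: "u \<in> finite_energy"
  have "(\<Sum>\<^sub>\<infinity>v\<in>-V0. \<bar>u v\<bar> * m v) \<le> (\<Sum>\<^sub>\<infinity>v\<in>-V0. D v powr (1 / p) * m v) * p_energy u powr (1 / p)"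
    by (intro l1_bound u D_root_summable pointwise_bound)
  also have "\<dots> \<le> dist_mean powr (1 / p) * \<mu> * p_energy u powr (1 / p)"
    by (intro mult_right_mono D_root_sum_le) simp
  finally show "(\<Sum>\<^sub>\<infinity>v\<in>-V0. \<bar>u v\<bar> * m v) \<le> dist_mean powr (1 / p) * \<mu> * p_energy u powr (1 / p)" .
qed

lemma torsional_rigidity_less_Mean:
  assumes "\<not> single_edge_graph b c V0"
  shows "torsional_rigidity p m b c V0 < ennpowr (vol m (- V0)) p * Mean_inv p m b V0"
proof -
  obtain \<kappa> where \<kappa>: "0 \<le> \<kappa>" "\<kappa> < dist_mean powr (1 / p) * \<mu>"
    "\<And>u. u \<in> finite_energy \<Longrightarrow> (\<Sum>\<^sub>\<infinity>v\<in>-V0. \<bar>u v\<bar> * m v) \<le> \<kappa> * p_energy u powr (1 / p)"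
    using strict_l1_bound[OF assms] by blast
  have "torsional_rigidity p m b c V0 \<le> ennreal (\<kappa> powr p)"
    by (intro torsional_rigidity_le \<kappa>)
  also have "\<dots> < ennreal ((dist_mean powr (1 / p) * \<mu>) powr p)"
    using \<kappa>(1,2) p by (intro ennreal_lessI powr_less_mono2) auto
  finally show ?thesis by (simp only: vol_powr_mult_Mean)
qed

section \<open>The torsion function\<close>

lemma torsion_function_iff:
  "torsion_function p m b c V0 u \<longleftrightarrow> u \<in> form.X \<and> (\<forall>h\<in>form.X. form.flux u h = form.load h)"
proof -
  have "1 / 2 * (\<Sum>\<^sub>\<infinity>(v, w)\<in>UNIV. b v w * (\<bar>u v - u w\<bar> powr (p - 2) * (u v - u w)) * (h v - h w))
        + (\<Sum>\<^sub>\<infinity>v\<in>UNIV. c v * (\<bar>u v\<bar> powr (p - 2) * u v) * h v) = form.flux u h"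
    if uh: "u \<in> form.X" "h \<in> form.X" for h
  proof -
    let ?k = "\<lambda>i. coeff_at i * signed_powr p (increment i u) * increment i h"
    have l: "?k (Inl x) = 1 / 2 * (case x of (v, w) \<Rightarrow> b v w * (\<bar>u v - u w\<bar> powr (p - 2) * (u v - u w)) * (h v - h w))"
      and r: "?k (Inr v) = c v * (\<bar>u v\<bar> powr (p - 2) * u v) * h v" for x v
      by (auto simp: coeff_at_def increment_def signed_powr_def split: prod.split)
    \<comment> \<open>Summability of the flux over the whole index type justifies splitting it into
      its edge part and its potential part.\<close>
    have "form.flux u h = (\<Sum>\<^sub>\<infinity>x. ?k (Inl x)) + (\<Sum>\<^sub>\<infinity>v. ?k (Inr v))"
      unfolding form.flux_def
      using form.flux_summable[OF uh] by (intro infsum_sum_type) (simp_all only: summable_on_sum_type_iff)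
    then show ?thesis unfolding l r infsum_cmult_right' by simp
  qed
  then show ?thesis
    unfolding torsion_function_def sobolev0_1_eq form_X[symmetric] form.load_def by auto
qed

lemma uniquely_torsional_admissible: "uniquely_torsional_admissible p m b c V0"
  unfolding uniquely_torsional_admissible_def torsion_function_iff
  using form.weak_solution_exists form.weak_solution_unique by blast

end

theorem theorem5p13:
  fixes p :: real
    and m :: "'v::countable \<Rightarrow> real"
    and b :: "'v \<Rightarrow> 'v \<Rightarrow> real"
    and c :: "'v \<Rightarrow> real"
    and V0 :: "'v set"
  assumes "1 < p"
    and "weighted_graph m b c"
    and "vol m UNIV < \<infinity>"
    and "V0 \<noteq> {}"
    and "V0 \<subset> UNIV"
    and "Mean_inv p m b V0 < \<infinity>"
  shows "bottom_spectrum p m b c V0 \<ge> 1 / (vol m (- V0) * Mean_inv p m b V0)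
    \<and> 1 / (vol m (- V0) * Mean_inv p m b V0) \<ge> 1 / (vol m (- V0) * Inr_inv p b V0)
    \<and> (\<exists>M::real. M > 0 \<and> (\<forall>u \<in> sobolev0 p p m b c V0.
          lnorm p m (- V0) u \<le> ennreal M * ennpowr (energy p b c u) (1 / p)))
    \<and> torsional_rigidity p m b c V0 \<le> ennpowr (vol m (- V0)) p * Mean_inv p m b V0
    \<and> (\<not> single_edge_graph b c V0 \<longrightarrow>
          torsional_rigidity p m b c V0 < ennpowr (vol m (- V0)) p * Mean_inv p m b V0)
    \<and> ennpowr (vol m (- V0)) p * Mean_inv p m b V0 \<le> ennpowr (vol m (- V0)) p * Inr_inv p b V0
    \<and> uniquely_torsional_admissible p m b c V0"
proof -
  interpret weighted_graph m b c by (rule assms(2))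
  interpret torsion_graph m b c p V0
    using assms by unfold_locales auto
  have "1 / (vol m (- V0) * Inr_inv p b V0) \<le> 1 / (vol m (- V0) * Mean_inv p m b V0)"
    by (intro one_divide_antimono_ennreal mult_left_mono Mean_le_Inr) simp
  moreover have "ennpowr (vol m (- V0)) p * Mean_inv p m b V0 \<le> ennpowr (vol m (- V0)) p * Inr_inv p b V0"
    by (intro mult_left_mono Mean_le_Inr) simp
  ultimately show ?thesis
    using bottom_spectrum_ge Poincare_inequality torsional_rigidity_le_Mean
      torsional_rigidity_less_Mean uniquely_torsional_admissible by blast
qed

end
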